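(* If $H_{\omega}$ denotes the $\mathrm{SupLat}$-FRT algebra of a non-degenerate set-theoretical YBE solution $(X,r)$, then any Drinfeld co-twist on $H_\omega$ induces a Drinfeld twist on $(X,r)$.
   Context: For a map $r:X^2\to X^2$, write $r_{12}=r\times \mathrm{id}_X$ and $r_{23}=\mathrm{id}_X\times r$. A set-theoretical YBE solution $(X,r)$ is a set $X$ with an invertible map $r:X^2\to X^2$ satisfying $r_{23}r_{12}r_{23}=r_{12}r_{23}r_{12}$. Write $r(x,y)=(\sigma_x(y),\gamma_y(x))$; $(X,r)$ is non-degenerate if all $\sigma_x,\gamma_y$ are bijections. A Drinfeld twist on $(X,r)$ is a triple of invertible maps $F:X^2\to X^2$, $\Phi,\Psi:X^3\to X^3$ with $(F\times\mathrm{id}_X)\Psi=(\mathrm{id}_X\times F)\Phi$, $\Phi(\mathrm{id}_X\times r)=(\mathrm{id}_X\times r)\Phi$, $\Psi(r\times\mathrm{id}_X)=(r\times \mathrm{id}_X)\Psi$. $\mathrm{SupLat}$ is the category of complete lattices and join-preserving maps, symmetric monoidal with tensor product $M\otimes N$ universal for maps $M\times N\to L$ preserving joins in each variable; the unit object is the two-element lattice $\mathcal{P}(1)=\{\emptyset,1\}$. $\emptyset$ also denotes the bottom element of a lattice. Hopf algebras are Hopf algebra objects in $\mathrm{SupLat}$, with counit $\epsilon$ and Sweedler notation $\Delta(a)=a_{(1)}\otimes a_{(2)}$ (joins suppressed). The $\mathrm{SupLat}$-FRT algebra $H_\omega$ of $(X,r)$: as an algebra in $\mathrm{SupLat}$ it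 is generated by elements $(x,y)_1$ and $(x,y)_2$ for $x,y\in X$ (i.e. it is the quotient of the power set of the free monoid on these symbols), subject to the relations $\bigvee_{a\in X}(x,a)_1.(x,a)_2=1=\bigvee_{a\in X}(a,x)_2.(a,x)_1$; $(x,a)_1.(y,a)_2=\emptyset=(a,x)_2.(a,y)_1$ when $x\neq y$; $(x,y)_1.(a,b)_1=(\sigma_x(a),\sigma_y(b))_1.(\gamma_a(x),\gamma_b(y))_1$, for all $a,b,x,y\in X$. It is a Hopf algebra with coalgebra structure determined multiplicatively by $\Delta((x,y)_i)=\bigvee_{a\in X}(x,a)_i\otimes(a,y)_i$ and $\epsilon((x,y)_i)=\delta_{x,y}$ for $i=1,2$ (where $\delta_{x,y}\in\mathcal{P}(1)$ is $1$ if $x=y$ and $\emptyset$ otherwise). A Drinfeld co-twist on a Hopf algebra $\mathcal{H}$ is a morphism $\mathcal{F}:\mathcal{H}\otimes\mathcal{H}\to\mathcal{P}(1)$ for which there is a morphism $\mathcal{F}^{-1}:\mathcal{H}\otimes\mathcal{H}\to\mathcal{P}(1)$ such that for all $a,b,c\in\mathcal{H}$: $\mathcal{F}^{-1}(a_{(1)},b_{(1)})\mathcal{F}(a_{(2)},b_{(2)})=\epsilon(a)\epsilon(b)=\mathcal{F}(a_{(1)},b_{(1)})\mathcal{F}^{-1}(a_{(2)},b_{(2)})$; $\mathcal{F}(a_{(1)}b_{(1)},c)\,\mathcal{F}(a_{(2)},b_{(2)})=\mathcal{F}(a,b_{(1)}c_{(1)})\,\mathcal{F}(b_{(2)},c_{(2)})$;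 and $\mathcal{F}(a,1)=\epsilon(a)=\mathcal{F}(1,a)$. *)

theory Defs
  imports "HOL-Algebra.Complete_Lattice" "HOL-Library.FuncSet"
begin

section \<open>Set-theoretical solutions and Drinfeld twists\<close>

text \<open>\<^term>\<open>on12 f\<close> is \<open>f \<times> id\<close> and \<^term>\<open>on23 f\<close> is \<open>id \<times> f\<close> on triples.\<close>

definition on12 :: "('x \<times> 'x \<Rightarrow> 'x \<times> 'x) \<Rightarrow> 'x \<times> 'x \<times> 'x \<Rightarrow> 'x \<times> 'x \<times> 'x" where
  "on12 f = (\<lambda>(x, y, z). let (a, b) = f (x, y) in (a, b, z))"

definition on23 :: "('x \<times> 'x \<Rightarrow> 'x \<times> 'x) \<Rightarrow> 'x \<times> 'x \<times> 'x \<Rightarrow> 'x \<times> 'x \<times> 'x" where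
  "on23 f = (\<lambda>(x, y, z). (x, f (y, z)))"

definition ybe_solution :: "'x set \<Rightarrow> ('x \<times> 'x \<Rightarrow> 'x \<times> 'x) \<Rightarrow> bool" where
  "ybe_solution X r \<longleftrightarrow>
     bij_betw r (X \<times> X) (X \<times> X) \<and>
     (\<forall>t \<in> X \<times> X \<times> X. on23 r (on12 r (on23 r t)) = on12 r (on23 r (on12 r t)))"

definition ybe_sigma :: "('x \<times> 'x \<Rightarrow> 'x \<times> 'x) \<Rightarrow> 'x \<Rightarrow> 'x \<Rightarrow> 'x" where
  "ybe_sigma r x y = fst (r (x, y))"

definition ybe_gamma :: "('x \<times> 'x \<Rightarrow> 'x \<times> 'x) \<Rightarrow> 'x \<Rightarrow> 'x \<Rightarrow> 'x" where
  "ybe_gamma r y x = snd (r (x, y))"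

definition nondegenerate :: "'x set \<Rightarrow> ('x \<times> 'x \<Rightarrow> 'x \<times> 'x) \<Rightarrow> bool" where
  "nondegenerate X r \<longleftrightarrow>
     (\<forall>x \<in> X. bij_betw (ybe_sigma r x) X X \<and> bij_betw (ybe_gamma r x) X X)"

definition drinfeld_twist ::
  "'x set \<Rightarrow> ('x \<times> 'x \<Rightarrow> 'x \<times> 'x) \<Rightarrow> ('x \<times> 'x \<Rightarrow> 'x \<times> 'x) \<Rightarrow>
   ('x \<times> 'x \<times> 'x \<Rightarrow> 'x \<times> 'x \<times> 'x) \<Rightarrow> ('x \<times> 'x \<times> 'x \<Rightarrow> 'x \<times> 'x \<times> 'x) \<Rightarrow> bool" where
  "drinfeld_twist X r F \<Phi> \<Psi> \<longleftrightarrow>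
     bij_betw F (X \<times> X) (X \<times> X) \<and>
     bij_betw \<Phi> (X \<times> X \<times> X) (X \<times> X \<times> X) \<and>
     bij_betw \<Psi> (X \<times> X \<times> X) (X \<times> X \<times> X) \<and>
     (\<forall>t \<in> X \<times> X \<times> X.
        on12 F (\<Psi> t) = on23 F (\<Phi> t) \<and>
        \<Phi> (on23 r t) = on23 r (\<Phi> t) \<and>
        \<Psi> (on12 r t) = on12 r (\<Psi> t))"


section \<open>Complete lattices and join-preserving maps\<close>

definition suplat_hom :: "('a, 'c) gorder_scheme \<Rightarrow> ('b, 'd) gorder_scheme \<Rightarrow> ('a \<Rightarrow> 'b) set" where
  "suplat_hom L M = {f \<in> carrier L \<rightarrow> carrier M. sup_pres L M f}"

text \<open>The monoidal unit \<open>P(1)\<close>.  Its product is intersection and its joins are unions.\<close>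

definition suplat_unit :: "unit set gorder" where
  "suplat_unit = \<lparr>carrier = Pow {()}, eq = (=), le = (\<subseteq>)\<rparr>"

text \<open>
  The tensor product of two complete lattices, realised by the subsets \<open>U\<close> of \<open>M \<times> N\<close> such that, in
  each variable separately, \<open>U\<close> contains a join if and only if it contains all the joinands (so \<open>U\<close>
  is also down-closed in each variable and contains all pairs with a bottom component).  The set
  \<open>U\<close> stands for the join of the pure tensors \<open>m \<otimes> n\<close> with \<open>(m, n) \<in> U\<close>.  Joins are
  closures of unions, and the map extending a bimorphism \<open>f\<close> sends \<open>U\<close> to \<open>\<Squnion> f(U)\<close>.
\<close>

definition tensor :: "('a, 'c) gorder_scheme \<Rightarrow> ('b, 'd) gorder_scheme \<Rightarrow> ('a \<times> 'b) set gorder"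
  where
  "tensor M N =
     \<lparr>carrier = {U. U \<subseteq> carrier M \<times> carrier N \<and>
        (\<forall>A n. A \<subseteq> carrier M \<longrightarrow> n \<in> carrier N \<longrightarrow>
           ((\<Squnion>\<^bsub>M\<^esub>A, n) \<in> U \<longleftrightarrow> (\<forall>a \<in> A. (a, n) \<in> U))) \<and>
        (\<forall>m B. m \<in> carrier M \<longrightarrow> B \<subseteq> carrier N \<longrightarrow>
           ((m, \<Squnion>\<^bsub>N\<^esub>B) \<in> U \<longleftrightarrow> (\<forall>b \<in> B. (m, b) \<in> U)))},
      eq = (=), le = (\<subseteq>)\<rparr>"

definition pure_tensor ::
  "('a, 'c) gorder_scheme \<Rightarrow> ('b, 'd) gorder_scheme \<Rightarrow> 'a \<Rightarrow> 'b \<Rightarrow> ('a \<times> 'b) set" where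
  "pure_tensor M N m n = \<Inter> {U \<in> carrier (tensor M N). (m, n) \<in> U}"

text \<open>The universal property of this construction.\<close>

lemma le_sup_iff:
  assumes "complete_lattice L" "A \<subseteq> carrier L" "s \<in> carrier L"
  shows "\<Squnion>\<^bsub>L\<^esub>A \<sqsubseteq>\<^bsub>L\<^esub> s \<longleftrightarrow> (\<forall>a \<in> A. a \<sqsubseteq>\<^bsub>L\<^esub> s)"
proof -
  interpret L: complete_lattice L by fact
  show ?thesis
    using L.sup_upper[OF assms(2)] L.sup_least[OF assms(2,3)] L.sup_closed[OF assms(2)] assms
    by (meson L.le_trans subsetD)
qed

lemma tensor_top:
  assumes "complete_lattice M" "complete_lattice N"
  shows "carrier M \<times> carrier N \<in> carrier (tensor M N)"
proof -
  interpret M: complete_lattice M by fact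
  interpret N: complete_lattice N by fact
  show ?thesis unfolding tensor_def by auto
qed

lemma tensor_memD1: "U \<in> carrier (tensor M N) \<Longrightarrow> A \<subseteq> carrier M \<Longrightarrow> n \<in> carrier N \<Longrightarrow>
    (\<Squnion>\<^bsub>M\<^esub>A, n) \<in> U \<longleftrightarrow> (\<forall>a \<in> A. (a, n) \<in> U)"
  and tensor_memD2: "U \<in> carrier (tensor M N) \<Longrightarrow> B \<subseteq> carrier N \<Longrightarrow> m \<in> carrier M \<Longrightarrow>
    (m, \<Squnion>\<^bsub>N\<^esub>B) \<in> U \<longleftrightarrow> (\<forall>b \<in> B. (m, b) \<in> U)"
  and tensor_subset: "U \<in> carrier (tensor M N) \<Longrightarrow> U \<subseteq> carrier M \<times> carrier N"
  and tensor_le: "U \<sqsubseteq>\<^bsub>tensor M N\<^esub> V \<longleftrightarrow> U \<subseteq> V"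
  by (simp_all add: tensor_def)

lemma tensorI:
  assumes "U \<subseteq> carrier M \<times> carrier N"
    "\<And>A n. A \<subseteq> carrier M \<Longrightarrow> n \<in> carrier N \<Longrightarrow> (\<Squnion>\<^bsub>M\<^esub>A, n) \<in> U \<longleftrightarrow> (\<forall>a \<in> A. (a, n) \<in> U)"
    "\<And>m B. m \<in> carrier M \<Longrightarrow> B \<subseteq> carrier N \<Longrightarrow> (m, \<Squnion>\<^bsub>N\<^esub>B) \<in> U \<longleftrightarrow> (\<forall>b \<in> B. (m, b) \<in> U)"
  shows "U \<in> carrier (tensor M N)"
  using assms by (simp add: tensor_def)

lemma tensor_Inter:
  assumes "\<U> \<subseteq> carrier (tensor M N)" "\<U> \<noteq> {}"
  shows "\<Inter>\<U> \<in> carrier (tensor M N)"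
proof (rule tensorI)
  have *: "\<And>U. U \<in> \<U> \<Longrightarrow> U \<in> carrier (tensor M N)" using assms by auto
  obtain U where U: "U \<in> \<U>" using assms by auto
  show "\<Inter>\<U> \<subseteq> carrier M \<times> carrier N" using tensor_subset[OF *[OF U]] U by (meson Inter_lower order_trans)
  show "(\<Squnion>\<^bsub>M\<^esub>A, n) \<in> \<Inter>\<U> \<longleftrightarrow> (\<forall>a \<in> A. (a, n) \<in> \<Inter>\<U>)" if "A \<subseteq> carrier M" "n \<in> carrier N" for A n
    using tensor_memD1[OF * that] by (simp add: Inter_iff) metis
  show "(m, \<Squnion>\<^bsub>N\<^esub>B) \<in> \<Inter>\<U> \<longleftrightarrow> (\<forall>b \<in> B. (m, b) \<in> \<Inter>\<U>)" if "m \<in> carrier M" "B \<subseteq> carrier N" for m B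
    using tensor_memD2[OF * that(2,1)] by (simp add: Inter_iff) metis
qed

lemma partial_order_tensor: "partial_order (tensor M N)"
  by unfold_locales (auto simp: tensor_def)

lemma complete_lattice_tensor:
  assumes "complete_lattice M" "complete_lattice N"
  shows "complete_lattice (tensor M N)"
proof -
  interpret T: partial_order "tensor M N" by (rule partial_order_tensor)
  show ?thesis
  proof (rule T.complete_lattice_criterion1)
    have "greatest (tensor M N) (carrier M \<times> carrier N) (carrier (tensor M N))"
      unfolding greatest_def tensor_le using tensor_top[OF assms] tensor_subset by blast
    then show "\<exists>g. greatest (tensor M N) g (carrier (tensor M N))" ..
    fix \<U> assume U: "\<U> \<subseteq> carrier (tensor M N)" "\<U> \<noteq> {}"
    have "greatest (tensor M N) (\<Inter>\<U>) (Lower (tensor M N) \<U>)"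
      unfolding greatest_def Lower_def tensor_le using tensor_Inter[OF U] U by blast
    then show "\<exists>i. greatest (tensor M N) i (Lower (tensor M N) \<U>)" ..
  qed
qed

lemma pure_tensor_in_iff:
  assumes "complete_lattice M" "complete_lattice N" "m \<in> carrier M" "n \<in> carrier N"
  shows "pure_tensor M N m n \<in> carrier (tensor M N)"
    and "U \<in> carrier (tensor M N) \<Longrightarrow> pure_tensor M N m n \<subseteq> U \<longleftrightarrow> (m, n) \<in> U"
proof -
  show "pure_tensor M N m n \<in> carrier (tensor M N)"
    unfolding pure_tensor_def
    by (rule tensor_Inter) (use tensor_top[OF assms(1,2)] assms in auto)
  show "pure_tensor M N m n \<subseteq> U \<longleftrightarrow> (m, n) \<in> U" if "U \<in> carrier (tensor M N)"
    using that unfolding pure_tensor_def by auto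
qed

lemma tensor_eq_sup_pure:
  assumes "complete_lattice M" "complete_lattice N" "U \<in> carrier (tensor M N)"
  shows "U = \<Squnion>\<^bsub>tensor M N\<^esub> {pure_tensor M N m n | m n. (m, n) \<in> U}"
proof -
  interpret T: complete_lattice "tensor M N" by (rule complete_lattice_tensor) fact+
  let ?P = "{pure_tensor M N m n | m n. (m, n) \<in> U}"
  have mn: "m \<in> carrier M \<and> n \<in> carrier N" if "(m, n) \<in> U" for m n
    using that tensor_subset[OF assms(3)] by auto
  have P: "?P \<subseteq> carrier (tensor M N)"
    using pure_tensor_in_iff(1)[OF assms(1,2)] mn by auto
  have iff: "\<Squnion>\<^bsub>tensor M N\<^esub> ?P \<subseteq> W \<longleftrightarrow> U \<subseteq> W" if W: "W \<in> carrier (tensor M N)" for W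
  proof -
    have "\<forall>m n. (m, n) \<in> U \<longrightarrow> (pure_tensor M N m n \<subseteq> W \<longleftrightarrow> (m, n) \<in> W)"
      using pure_tensor_in_iff(2)[OF assms(1,2) _ _ W] mn by auto
    moreover have "(\<forall>a \<in> ?P. a \<subseteq> W) \<longleftrightarrow> (\<forall>m n. (m, n) \<in> U \<longrightarrow> pure_tensor M N m n \<subseteq> W)"
      by blast
    moreover have "U \<subseteq> W \<longleftrightarrow> (\<forall>m n. (m, n) \<in> U \<longrightarrow> (m, n) \<in> W)" by auto
    ultimately show ?thesis
      using le_sup_iff[OF T.complete_lattice_axioms P W] unfolding tensor_le by simp
  qed
  show ?thesis
    using iff[OF assms(3)] iff[OF T.sup_closed[OF P]] by blast
qed

definition bimorphism ::
  "('a, 'd) gorder_scheme \<Rightarrow> ('b, 'e) gorder_scheme \<Rightarrow> ('c, 'f) gorder_scheme \<Rightarrow>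
   ('a \<Rightarrow> 'b \<Rightarrow> 'c) \<Rightarrow> bool" where
  "bimorphism M N L f \<longleftrightarrow>
     (\<forall>m \<in> carrier M. f m \<in> suplat_hom N L) \<and>
     (\<forall>n \<in> carrier N. (\<lambda>m. f m n) \<in> suplat_hom M L)"

theorem tensor_universal:
  assumes M: "complete_lattice M" and N: "complete_lattice N" and L: "complete_lattice L"
    and f: "bimorphism M N L f"
  shows "\<exists>g \<in> suplat_hom (tensor M N) L.
           \<forall>m \<in> carrier M. \<forall>n \<in> carrier N. g (pure_tensor M N m n) = f m n"
    and "\<lbrakk>g \<in> suplat_hom (tensor M N) L; h \<in> suplat_hom (tensor M N) L;
          \<forall>m \<in> carrier M. \<forall>n \<in> carrier N. g (pure_tensor M N m n) = h (pure_tensor M N m n)\<rbrakk>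
         \<Longrightarrow> \<forall>U \<in> carrier (tensor M N). g U = h U"
proof -
  interpret M: complete_lattice M by fact
  interpret N: complete_lattice N by fact
  interpret L: complete_lattice L by fact
  interpret T: complete_lattice "tensor M N" by (rule complete_lattice_tensor) fact+
  define g where "g = (\<lambda>U. \<Squnion>\<^bsub>L\<^esub> (\<lambda>(m, n). f m n) ` U)"
  have fc: "f m n \<in> carrier L" if "m \<in> carrier M" "n \<in> carrier N" for m n
    using f that unfolding bimorphism_def suplat_hom_def by auto
  have im: "(\<lambda>(m, n). f m n) ` U \<subseteq> carrier L" if "U \<in> carrier (tensor M N)" for U
    using tensor_subset[OF that] fc by auto
  have gc: "g U \<in> carrier L" if "U \<in> carrier (tensor M N)" for U
    unfolding g_def using im[OF that] by simp
  define V where "V = (\<lambda>s. {(m, n). m \<in> carrier M \<and> n \<in> carrier N \<and> f m n \<sqsubseteq>\<^bsub>L\<^esub> s})"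
  have V: "V s \<in> carrier (tensor M N)" if s: "s \<in> carrier L" for s
  proof -
    have 1: "f (\<Squnion>\<^bsub>M\<^esub>A) n \<sqsubseteq>\<^bsub>L\<^esub> s \<longleftrightarrow> (\<forall>a\<in>A. f a n \<sqsubseteq>\<^bsub>L\<^esub> s)"
      if "A \<subseteq> carrier M" "n \<in> carrier N" for A n
    proof -
      have "f (\<Squnion>\<^bsub>M\<^esub>A) n = \<Squnion>\<^bsub>L\<^esub> ((\<lambda>m. f m n) ` A)"
        using f that unfolding bimorphism_def suplat_hom_def sup_pres_def by auto
      moreover have "(\<lambda>m. f m n) ` A \<subseteq> carrier L" using that fc by auto
      ultimately show ?thesis
        using le_sup_iff[OF L _ s, of "(\<lambda>m. f m n) ` A"] by simp
    qed
    have 2: "f m (\<Squnion>\<^bsub>N\<^esub>B) \<sqsubseteq>\<^bsub>L\<^esub> s \<longleftrightarrow> (\<forall>b\<in>B. f m b \<sqsubseteq>\<^bsub>L\<^esub> s)"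
      if "m \<in> carrier M" "B \<subseteq> carrier N" for m B
    proof -
      have "f m (\<Squnion>\<^bsub>N\<^esub>B) = \<Squnion>\<^bsub>L\<^esub> (f m ` B)"
        using f that unfolding bimorphism_def suplat_hom_def sup_pres_def by auto
      moreover have "f m ` B \<subseteq> carrier L" using that fc by auto
      ultimately show ?thesis
        using le_sup_iff[OF L _ s, of "f m ` B"] by simp
    qed
    show ?thesis by (rule tensorI) (use 1 2 in \<open>auto simp: V_def\<close>)
  qed
  have gle: "g U \<sqsubseteq>\<^bsub>L\<^esub> s \<longleftrightarrow> U \<subseteq> V s" if "U \<in> carrier (tensor M N)" "s \<in> carrier L" for U s
    using le_sup_iff[OF L im[OF that(1)] that(2)]
      tensor_subset[OF that(1)]
    unfolding g_def V_def by auto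
  have Tle: "U \<sqsubseteq>\<^bsub>tensor M N\<^esub> U' \<longleftrightarrow> U \<subseteq> U'" for U U' by (simp add: tensor_def)
  have "sup_pres (tensor M N) L g" unfolding sup_pres_def
  proof (intro conjI allI impI)
    fix \<A> assume A: "\<A> \<subseteq> carrier (tensor M N)"
    have gA: "g ` \<A> \<subseteq> carrier L" using A gc by auto
    show "g (\<Squnion>\<^bsub>tensor M N\<^esub>\<A>) = \<Squnion>\<^bsub>L\<^esub>(g ` \<A>)"
    proof -
      have sc: "\<Squnion>\<^bsub>tensor M N\<^esub>\<A> \<in> carrier (tensor M N)" using A by simp
      have *: "g (\<Squnion>\<^bsub>tensor M N\<^esub>\<A>) \<sqsubseteq>\<^bsub>L\<^esub> s \<longleftrightarrow> \<Squnion>\<^bsub>L\<^esub>(g ` \<A>) \<sqsubseteq>\<^bsub>L\<^esub> s" if "s \<in> carrier L" for s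
      proof -
        have "g (\<Squnion>\<^bsub>tensor M N\<^esub>\<A>) \<sqsubseteq>\<^bsub>L\<^esub> s \<longleftrightarrow> (\<forall>U\<in>\<A>. U \<subseteq> V s)"
          using gle[OF sc that] le_sup_iff[OF T.complete_lattice_axioms A V[OF that]] Tle by simp
        also have "\<dots> \<longleftrightarrow> (\<forall>U\<in>\<A>. g U \<sqsubseteq>\<^bsub>L\<^esub> s)" using gle[OF subsetD[OF A] that] by simp
        finally show ?thesis using le_sup_iff[OF L gA that] by simp
      qed
      show ?thesis
        using *[OF L.sup_closed[OF gA]] *[OF gc[OF sc]] gc[OF sc] L.sup_closed[OF gA]
        by (meson L.le_antisym L.le_refl)
    qed
  qed (rule T.complete_lattice_axioms L)+
  then have "g \<in> suplat_hom (tensor M N) L" unfolding suplat_hom_def using gc by blast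
  moreover have "g (pure_tensor M N m n) = f m n" if "m \<in> carrier M" "n \<in> carrier N" for m n
  proof -
    note p = pure_tensor_in_iff[OF M N that]
    have *: "g (pure_tensor M N m n) \<sqsubseteq>\<^bsub>L\<^esub> s \<longleftrightarrow> f m n \<sqsubseteq>\<^bsub>L\<^esub> s" if "s \<in> carrier L" for s
      using gle[OF p(1) that] p(2)[OF V[OF that]] \<open>m \<in> _\<close> \<open>n \<in> _\<close> by (auto simp: V_def)
    show ?thesis
      using *[OF fc[OF that]] *[OF gc[OF p(1)]] fc[OF that] gc[OF p(1)]
      by (meson L.le_antisym L.le_refl)
  qed
  ultimately show "\<exists>g \<in> suplat_hom (tensor M N) L.
           \<forall>m \<in> carrier M. \<forall>n \<in> carrier N. g (pure_tensor M N m n) = f m n" by blast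
  show "\<forall>U \<in> carrier (tensor M N). g U = h U"
    if g: "g \<in> suplat_hom (tensor M N) L" and h: "h \<in> suplat_hom (tensor M N) L"
      and eq: "\<forall>m \<in> carrier M. \<forall>n \<in> carrier N. g (pure_tensor M N m n) = h (pure_tensor M N m n)"
    for g h
  proof
    fix U assume U: "U \<in> carrier (tensor M N)"
    let ?P = "{pure_tensor M N m n | m n. (m, n) \<in> U}"
    have mn: "m \<in> carrier M \<and> n \<in> carrier N" if "(m, n) \<in> U" for m n
      using that tensor_subset[OF U] by auto
    have P: "?P \<subseteq> carrier (tensor M N)"
      using pure_tensor_in_iff(1)[OF M N] mn by auto
    have "g ` ?P = h ` ?P" using eq mn by (intro image_cong) auto
    moreover have "g (\<Squnion>\<^bsub>tensor M N\<^esub> ?P) = \<Squnion>\<^bsub>L\<^esub>(g ` ?P)" "h (\<Squnion>\<^bsub>tensor M N\<^esub> ?P) = \<Squnion>\<^bsub>L\<^esub>(h ` ?P)"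
      using g h P unfolding suplat_hom_def sup_pres_def by auto
    ultimately show "g U = h U" using tensor_eq_sup_pure[OF M N U] by simp
  qed
qed

lemma pure_tensor_bimorphism:
  assumes M: "complete_lattice M" and N: "complete_lattice N"
  shows "bimorphism M N (tensor M N) (pure_tensor M N)"
proof -
  interpret M: complete_lattice M by fact
  interpret N: complete_lattice N by fact
  interpret T: complete_lattice "tensor M N" by (rule complete_lattice_tensor) fact+
  have Tle: "U \<sqsubseteq>\<^bsub>tensor M N\<^esub> U' \<longleftrightarrow> U \<subseteq> U'" for U U' by (simp add: tensor_def)
  note p = pure_tensor_in_iff[OF M N]
  have U1: "(\<Squnion>\<^bsub>M\<^esub>A, n) \<in> U \<longleftrightarrow> (\<forall>a \<in> A. (a, n) \<in> U)"
    if "U \<in> carrier (tensor M N)" "A \<subseteq> carrier M" "n \<in> carrier N" for U A n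
    using tensor_memD1[OF that] .
  have U2: "(m, \<Squnion>\<^bsub>N\<^esub>B) \<in> U \<longleftrightarrow> (\<forall>b \<in> B. (m, b) \<in> U)"
    if "U \<in> carrier (tensor M N)" "B \<subseteq> carrier N" "m \<in> carrier M" for U B m
    using tensor_memD2[OF that] .
  have eqI: "P = Q" if "P \<in> carrier (tensor M N)" "Q \<in> carrier (tensor M N)"
    "\<And>U. U \<in> carrier (tensor M N) \<Longrightarrow> P \<subseteq> U \<longleftrightarrow> Q \<subseteq> U" for P Q
    using that by blast
  have "pure_tensor M N (\<Squnion>\<^bsub>M\<^esub>A) n = \<Squnion>\<^bsub>tensor M N\<^esub> ((\<lambda>m. pure_tensor M N m n) ` A)"
    if A: "A \<subseteq> carrier M" and n: "n \<in> carrier N" for A n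
  proof (rule eqI)
    have S: "(\<lambda>m. pure_tensor M N m n) ` A \<subseteq> carrier (tensor M N)" using p(1) A n by auto
    then show "\<Squnion>\<^bsub>tensor M N\<^esub> ((\<lambda>m. pure_tensor M N m n) ` A) \<in> carrier (tensor M N)" by simp
    show "pure_tensor M N (\<Squnion>\<^bsub>M\<^esub>A) n \<in> carrier (tensor M N)" using p(1) A n by simp
    fix U assume U: "U \<in> carrier (tensor M N)"
    have "\<forall>a \<in> A. pure_tensor M N a n \<subseteq> U \<longleftrightarrow> (a, n) \<in> U" using p(2)[OF subsetD[OF A] n U] by simp
    then show "pure_tensor M N (\<Squnion>\<^bsub>M\<^esub>A) n \<subseteq> U \<longleftrightarrow>
        \<Squnion>\<^bsub>tensor M N\<^esub> ((\<lambda>m. pure_tensor M N m n) ` A) \<subseteq> U"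
      using p(2)[OF M.sup_closed[OF A] n U] U1[OF U A n]
        le_sup_iff[OF T.complete_lattice_axioms S U] Tle by simp
  qed
  moreover have "pure_tensor M N m (\<Squnion>\<^bsub>N\<^esub>B) = \<Squnion>\<^bsub>tensor M N\<^esub> (pure_tensor M N m ` B)"
    if B: "B \<subseteq> carrier N" and m: "m \<in> carrier M" for B m
  proof (rule eqI)
    have S: "pure_tensor M N m ` B \<subseteq> carrier (tensor M N)" using p(1) B m by auto
    then show "\<Squnion>\<^bsub>tensor M N\<^esub> (pure_tensor M N m ` B) \<in> carrier (tensor M N)" by simp
    show "pure_tensor M N m (\<Squnion>\<^bsub>N\<^esub>B) \<in> carrier (tensor M N)" using p(1) B m by simp
    fix U assume U: "U \<in> carrier (tensor M N)"
    have "\<forall>b \<in> B. pure_tensor M N m b \<subseteq> U \<longleftrightarrow> (m, b) \<in> U" using p(2)[OF m subsetD[OF B] U] by simp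
    then show "pure_tensor M N m (\<Squnion>\<^bsub>N\<^esub>B) \<subseteq> U \<longleftrightarrow> \<Squnion>\<^bsub>tensor M N\<^esub> (pure_tensor M N m ` B) \<subseteq> U"
      using p(2)[OF m N.sup_closed[OF B] U] U2[OF U B m]
        le_sup_iff[OF T.complete_lattice_axioms S U] Tle by simp
  qed
  ultimately show ?thesis
    unfolding bimorphism_def suplat_hom_def sup_pres_def
    using M N T.complete_lattice_axioms p(1) by auto
qed

record 'a suplat_algebra = "'a gorder" +
  amult :: "'a \<Rightarrow> 'a \<Rightarrow> 'a"
  aone :: 'a

record 'a suplat_bialgebra = "'a suplat_algebra" +
  comult :: "'a \<Rightarrow> ('a \<times> 'a) set"
  counit :: "'a \<Rightarrow> unit set"

definition tensor_mult ::
  "('a, 'c) suplat_algebra_scheme \<Rightarrow> ('a \<times> 'a) set \<Rightarrow> ('a \<times> 'a) set \<Rightarrow> ('a \<times> 'a) set" where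
  "tensor_mult H U V =
     \<Squnion>\<^bsub>tensor H H\<^esub> {pure_tensor H H (amult H a c) (amult H b d) | a b c d. (a, b) \<in> U \<and> (c, d) \<in> V}"

definition tensor_one :: "('a, 'c) suplat_algebra_scheme \<Rightarrow> ('a \<times> 'a) set" where
  "tensor_one H = pure_tensor H H (aone H) (aone H)"


section \<open>Drinfeld co-twists\<close>

text \<open>
  A co-twist is a map on \<open>H \<otimes> H\<close>; \<open>\<F>(a, b)\<close> means its value at \<open>a \<otimes> b\<close>.
  As an element of \<open>H \<otimes> H\<close>, the set \<open>comult H a\<close> is the join of the \<open>a1 \<otimes> a2\<close> with
  \<open>(a1, a2) \<in> comult H a\<close>, so the suppressed join of Sweedler notation is the union over these
  pairs.  The antipode of a Hopf algebra does not enter.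
\<close>

definition drinfeld_cotwist ::
  "('a, 'c) suplat_bialgebra_scheme \<Rightarrow> (('a \<times> 'a) set \<Rightarrow> unit set) \<Rightarrow> bool" where
  "drinfeld_cotwist H \<F> \<longleftrightarrow>
     \<F> \<in> suplat_hom (tensor H H) suplat_unit \<and>
     (\<exists>\<G> \<in> suplat_hom (tensor H H) suplat_unit.
        \<forall>a \<in> carrier H. \<forall>b \<in> carrier H.
          (\<Union>(a1, a2) \<in> comult H a. \<Union>(b1, b2) \<in> comult H b.
             \<G> (pure_tensor H H a1 b1) \<inter> \<F> (pure_tensor H H a2 b2)) = counit H a \<inter> counit H b \<and>
          (\<Union>(a1, a2) \<in> comult H a. \<Union>(b1, b2) \<in> comult H b.
             \<F> (pure_tensor H H a1 b1) \<inter> \<G> (pure_tensor H H a2 b2)) = counit H a \<inter> counit H b) \<and>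
     (\<forall>a \<in> carrier H. \<forall>b \<in> carrier H. \<forall>c \<in> carrier H.
        (\<Union>(a1, a2) \<in> comult H a. \<Union>(b1, b2) \<in> comult H b.
           \<F> (pure_tensor H H (amult H a1 b1) c) \<inter> \<F> (pure_tensor H H a2 b2)) =
        (\<Union>(b1, b2) \<in> comult H b. \<Union>(c1, c2) \<in> comult H c.
           \<F> (pure_tensor H H a (amult H b1 c1)) \<inter> \<F> (pure_tensor H H b2 c2))) \<and>
     (\<forall>a \<in> carrier H.
        \<F> (pure_tensor H H a (aone H)) = counit H a \<and>
        \<F> (pure_tensor H H (aone H) a) = counit H a)"


section \<open>The FRT algebra\<close>

text \<open>\<open>Gen1 x y\<close> and \<open>Gen2 x y\<close> are \<open>(x, y)\<^sub>1\<close> and \<open>(x, y)\<^sub>2\<close>; words are lists.\<close>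

datatype 'x gen = Gen1 'x 'x | Gen2 'x 'x

definition frt_words :: "'x set \<Rightarrow> 'x gen list set" where
  "frt_words X = lists {g. \<exists>x \<in> X. \<exists>y \<in> X. g = Gen1 x y \<or> g = Gen2 x y}"

definition conc :: "'b list set \<Rightarrow> 'b list set \<Rightarrow> 'b list set" where
  "conc A B = {u @ v | u v. u \<in> A \<and> v \<in> B}"

text \<open>
  The defining relations between elements of the power set of the free monoid, where \<open>1\<close> is
  \<open>{[]}\<close> and the join of a family of words is the set of these words.
\<close>

inductive frt_rel :: "'x set \<Rightarrow> ('x \<times> 'x \<Rightarrow> 'x \<times> 'x) \<Rightarrow> 'x gen list set \<Rightarrow> 'x gen list set \<Rightarrow> bool"
  for X r where
  join12: "x \<in> X \<Longrightarrow> frt_rel X r {[Gen1 x a, Gen2 x a] | a. a \<in> X} {[]}"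
| join21: "x \<in> X \<Longrightarrow> frt_rel X r {[Gen2 a x, Gen1 a x] | a. a \<in> X} {[]}"
| orth12: "\<lbrakk>x \<in> X; y \<in> X; a \<in> X; x \<noteq> y\<rbrakk> \<Longrightarrow> frt_rel X r {[Gen1 x a, Gen2 y a]} {}"
| orth21: "\<lbrakk>x \<in> X; y \<in> X; a \<in> X; x \<noteq> y\<rbrakk> \<Longrightarrow> frt_rel X r {[Gen2 a x, Gen1 a y]} {}"
| braid: "\<lbrakk>x \<in> X; y \<in> X; a \<in> X; b \<in> X\<rbrakk> \<Longrightarrow>
    frt_rel X r {[Gen1 x y, Gen1 a b]}
      {[Gen1 (ybe_sigma r x a) (ybe_sigma r y b), Gen1 (ybe_gamma r a x) (ybe_gamma r b y)]}"

text \<open>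
  The least congruence for arbitrary joins and multiplication containing the relations; in
  \<open>Sup\<close> the set \<open>R\<close> is a family of congruent pairs.
\<close>

inductive frt_cong :: "'x set \<Rightarrow> ('x \<times> 'x \<Rightarrow> 'x \<times> 'x) \<Rightarrow> 'x gen list set \<Rightarrow> 'x gen list set \<Rightarrow> bool"
  for X r where
  rel: "frt_rel X r A B \<Longrightarrow> frt_cong X r A B"
| refl: "A \<subseteq> frt_words X \<Longrightarrow> frt_cong X r A A"
| sym: "frt_cong X r A B \<Longrightarrow> frt_cong X r B A"
| trans: "\<lbrakk>frt_cong X r A B; frt_cong X r B C\<rbrakk> \<Longrightarrow> frt_cong X r A C"
| mult: "\<lbrakk>frt_cong X r A B; frt_cong X r C D\<rbrakk> \<Longrightarrow> frt_cong X r (conc A C) (conc B D)"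
| Sup: "\<forall>(A, B) \<in> R. frt_cong X r A B \<Longrightarrow> frt_cong X r (\<Union>(fst ` R)) (\<Union>(snd ` R))"

definition frt_class :: "'x set \<Rightarrow> ('x \<times> 'x \<Rightarrow> 'x \<times> 'x) \<Rightarrow> 'x gen list set \<Rightarrow> 'x gen list set set"
  where
  "frt_class X r A = {(A, B). frt_cong X r A B} `` {A}"

text \<open>
  The quotient.  For its order, \<open>[A] \<le> [B]\<close> iff \<open>[A \<union> B] = [B]\<close> iff some
  representative of \<open>[A]\<close> is contained in some representative of \<open>[B]\<close>.
\<close>

definition frt_algebra ::
  "'x set \<Rightarrow> ('x \<times> 'x \<Rightarrow> 'x \<times> 'x) \<Rightarrow> 'x gen list set set suplat_algebra" where
  "frt_algebra X r =
     \<lparr>carrier = Pow (frt_words X) // {(A, B). frt_cong X r A B},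
      eq = (=),
      le = (\<lambda>P Q. \<exists>A \<in> P. \<exists>B \<in> Q. A \<subseteq> B),
      amult = (\<lambda>P Q. \<Union>A \<in> P. \<Union>B \<in> Q. frt_class X r (conc A B)),
      aone = frt_class X r {[]}\<rparr>"

text \<open>This quotient is a complete lattice, with joins given by unions of representatives.\<close>

lemma frt_cong_words: "frt_cong X r A B \<Longrightarrow> ybe_solution X r \<Longrightarrow> A \<subseteq> frt_words X \<and> B \<subseteq> frt_words X"
proof (induction rule: frt_cong.induct)
  case (rel A B)
  have "ybe_sigma r x y \<in> X" "ybe_gamma r x y \<in> X" if "x \<in> X" "y \<in> X" for x y
    using rel(2) that unfolding ybe_solution_def ybe_sigma_def ybe_gamma_def
    by (metis SigmaI bij_betwE mem_Times_iff)+
  with rel(1) show ?case by cases (auto simp: frt_words_def)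
next
  case (mult A B C D)
  then show ?case by (fastforce simp: conc_def frt_words_def)
next
  case (Sup R)
  then show ?case by fastforce
qed auto

lemma frt_equiv: "ybe_solution X r \<Longrightarrow> equiv (Pow (frt_words X)) {(A, B). frt_cong X r A B}"
  using frt_cong_words[of X r]
  by (auto simp: equiv_def refl_on_def sym_def trans_def intro: frt_cong.intros)

lemma frt_Union:
  assumes "\<And>i. i \<in> I \<Longrightarrow> frt_cong X r (A i) (B i)"
  shows "frt_cong X r (\<Union>i\<in>I. A i) (\<Union>i\<in>I. B i)"
proof -
  have "frt_cong X r (\<Union>(fst ` (\<lambda>i. (A i, B i)) ` I)) (\<Union>(snd ` (\<lambda>i. (A i, B i)) ` I))"
    by (rule frt_cong.Sup) (use assms in auto)
  then show ?thesis by (simp add: image_image)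
qed

lemma frt_Un:
  assumes "frt_cong X r A A'" "frt_cong X r B B'"
  shows "frt_cong X r (A \<union> B) (A' \<union> B')"
proof -
  have "frt_cong X r (\<Union>b\<in>{True, False}. if b then A else B) (\<Union>b\<in>{True, False}. if b then A' else B')"
    by (rule frt_Union) (use assms in auto)
  then show ?thesis by (simp add: Un_commute)
qed

lemma frt_le_iff:
  assumes r: "ybe_solution X r" and "A \<subseteq> frt_words X" "B \<subseteq> frt_words X"
  shows "frt_class X r A \<sqsubseteq>\<^bsub>frt_algebra X r\<^esub> frt_class X r B \<longleftrightarrow> frt_cong X r (A \<union> B) B"
proof
  assume "frt_class X r A \<sqsubseteq>\<^bsub>frt_algebra X r\<^esub> frt_class X r B"
  then obtain A' B' where *: "frt_cong X r A A'" "frt_cong X r B B'" "A' \<subseteq> B'"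
    by (auto simp: frt_algebra_def frt_class_def)
  have "frt_cong X r (A \<union> B) (A' \<union> B')"
    using frt_Un *(1,2) .
  with * show "frt_cong X r (A \<union> B) B"
    by (metis frt_cong.sym frt_cong.trans subset_Un_eq)
next
  assume "frt_cong X r (A \<union> B) B"
  then show "frt_class X r A \<sqsubseteq>\<^bsub>frt_algebra X r\<^esub> frt_class X r B"
    using assms unfolding frt_algebra_def frt_class_def
    by (auto intro!: bexI[of _ A] bexI[of _ "A \<union> B"] intro: frt_cong.intros)
qed

lemma frt_carrier: "carrier (frt_algebra X r) = frt_class X r ` Pow (frt_words X)"
  by (auto simp: frt_algebra_def quotient_def frt_class_def)

lemma frt_class_eq_iff: "ybe_solution X r \<Longrightarrow> A \<subseteq> frt_words X \<Longrightarrow> B \<subseteq> frt_words X \<Longrightarrow>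
  frt_class X r A = frt_class X r B \<longleftrightarrow> frt_cong X r A B"
  unfolding frt_class_def using eq_equiv_class_iff[OF frt_equiv, of X r A B] by auto

lemma frt_lub:
  assumes r: "ybe_solution X r" and A: "\<A> \<subseteq> Pow (frt_words X)"
  shows "least (frt_algebra X r) (frt_class X r (\<Union>\<A>))
           (Upper (frt_algebra X r) (frt_class X r ` \<A>))"
proof -
  let ?H = "frt_algebra X r"
  have UA: "\<Union>\<A> \<subseteq> frt_words X" using A by auto
  have "frt_class X r a \<sqsubseteq>\<^bsub>?H\<^esub> frt_class X r (\<Union>\<A>)" if "a \<in> \<A>" for a
  proof -
    have "a \<union> \<Union>\<A> = \<Union>\<A>" "a \<subseteq> frt_words X" using that A by auto
    then show ?thesis using frt_le_iff[OF r _ UA] UA by (auto intro: frt_cong.refl)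
  qed
  moreover have "frt_class X r (\<Union>\<A>) \<sqsubseteq>\<^bsub>?H\<^esub> frt_class X r B"
    if B: "B \<subseteq> frt_words X" and ub: "\<And>a. a \<in> \<A> \<Longrightarrow> frt_class X r a \<sqsubseteq>\<^bsub>?H\<^esub> frt_class X r B" for B
  proof -
    have "frt_cong X r (a \<union> B) B" if "a \<in> \<A>" for a
      using frt_le_iff[OF r _ B] ub[OF that] A that by auto
    then have "frt_cong X r (\<Union>a\<in>insert {} \<A>. a \<union> B) (\<Union>a\<in>insert {} \<A>. B)"
      using B by (intro frt_Union) (auto intro: frt_cong.refl)
    moreover have "(\<Union>a\<in>insert {} \<A>. a \<union> B) = \<Union>\<A> \<union> B" "(\<Union>a\<in>insert {} \<A>. B) = B" by auto
    ultimately show ?thesis using frt_le_iff[OF r UA B] by simp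
  qed
  ultimately show ?thesis
    using A UA unfolding least_def Upper_def frt_carrier by (auto simp: subset_iff)
qed

lemma complete_lattice_frt:
  assumes r: "ybe_solution X r"
  shows "complete_lattice (frt_algebra X r)"
proof -
  let ?H = "frt_algebra X r"
  have "partial_order ?H"
  proof
    have eq: "eq ?H = (=)" by (simp add: frt_algebra_def)
    fix x y z
    show "x .=\<^bsub>?H\<^esub> x" by (simp add: eq)
    show "x .=\<^bsub>?H\<^esub> y \<Longrightarrow> y .=\<^bsub>?H\<^esub> x" by (simp add: eq)
    show "x .=\<^bsub>?H\<^esub> y \<Longrightarrow> y .=\<^bsub>?H\<^esub> z \<Longrightarrow> x .=\<^bsub>?H\<^esub> z" by (simp add: eq)
    show "eq ?H = (=)" by (rule eq)
    fix w
    show "x .=\<^bsub>?H\<^esub> y \<Longrightarrow> z .=\<^bsub>?H\<^esub> w \<Longrightarrow> x \<sqsubseteq>\<^bsub>?H\<^esub> z = (y \<sqsubseteq>\<^bsub>?H\<^esub> w)" by (simp add: eq)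
    assume x: "x \<in> carrier ?H"
    then obtain A where A: "A \<subseteq> frt_words X" "x = frt_class X r A" by (auto simp: frt_carrier)
    show "x \<sqsubseteq>\<^bsub>?H\<^esub> x" using A frt_le_iff[OF r] by (auto intro: frt_cong.refl)
    assume "y \<in> carrier ?H"
    then obtain B where B: "B \<subseteq> frt_words X" "y = frt_class X r B" by (auto simp: frt_carrier)
    show "x .=\<^bsub>?H\<^esub> y" if xy: "x \<sqsubseteq>\<^bsub>?H\<^esub> y" and yx: "y \<sqsubseteq>\<^bsub>?H\<^esub> x"
    proof -
      have "frt_cong X r (A \<union> B) B" "frt_cong X r (B \<union> A) A"
        using xy yx A B frt_le_iff[OF r] by simp_all
      then have "frt_cong X r A B" by (metis Un_commute frt_cong.sym frt_cong.trans)
      then show ?thesis using A B frt_class_eq_iff[OF r A(1) B(1)] eq by simp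
    qed
    assume "z \<in> carrier ?H"
    then obtain C where C: "C \<subseteq> frt_words X" "z = frt_class X r C" by (auto simp: frt_carrier)
    assume xy: "x \<sqsubseteq>\<^bsub>?H\<^esub> y" and yz: "y \<sqsubseteq>\<^bsub>?H\<^esub> z"
    have 1: "frt_cong X r (A \<union> B) B" "frt_cong X r (B \<union> C) C"
      using xy yz A B C frt_le_iff[OF r] by simp_all
    have "frt_cong X r (A \<union> C) (A \<union> (B \<union> C))"
      using frt_Un[OF frt_cong.refl[OF A(1)] frt_cong.sym[OF 1(2)]] .
    moreover have "frt_cong X r ((A \<union> B) \<union> C) (B \<union> C)"
      using frt_Un[OF 1(1) frt_cong.refl[OF C(1)]] .
    ultimately have "frt_cong X r (A \<union> C) C"
      using 1 by (metis Un_assoc frt_cong.trans)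
    then show "x \<sqsubseteq>\<^bsub>?H\<^esub> z" using A C frt_le_iff[OF r] by simp
  qed
  then interpret H: partial_order ?H .
  have lub: "\<exists>s. least ?H s (Upper ?H \<X>)" if X: "\<X> \<subseteq> carrier ?H" for \<X>
  proof -
    from X obtain \<A> where "\<A> \<subseteq> Pow (frt_words X)" "\<X> = frt_class X r ` \<A>"
      unfolding frt_carrier by (meson subset_imageE)
    then show ?thesis using frt_lub[OF r] by blast
  qed
  show ?thesis
  proof (rule H.complete_latticeI)
    show "\<exists>s. least ?H s (Upper ?H A)" if "A \<subseteq> carrier ?H" for A using lub[OF that] .
    fix A assume A: "A \<subseteq> carrier ?H"
    have LA: "Lower ?H A \<subseteq> carrier ?H" by auto
    from lub[OF LA] obtain s where s: "least ?H s (Upper ?H (Lower ?H A))" by blast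
    then have "greatest ?H s (Lower ?H A)"
      using A unfolding greatest_def least_def Upper_def Lower_def by blast
    then show "\<exists>i. greatest ?H i (Lower ?H A)" by blast
  qed
qed

fun frt_comult_gen ::
  "'x set \<Rightarrow> ('x \<times> 'x \<Rightarrow> 'x \<times> 'x) \<Rightarrow> 'x gen \<Rightarrow> ('x gen list set set \<times> 'x gen list set set) set"
  where
  "frt_comult_gen X r (Gen1 x y) =
     \<Squnion>\<^bsub>tensor (frt_algebra X r) (frt_algebra X r)\<^esub>
       {pure_tensor (frt_algebra X r) (frt_algebra X r)
          (frt_class X r {[Gen1 x a]}) (frt_class X r {[Gen1 a y]}) | a. a \<in> X}"
| "frt_comult_gen X r (Gen2 x y) =
     \<Squnion>\<^bsub>tensor (frt_algebra X r) (frt_algebra X r)\<^esub>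
       {pure_tensor (frt_algebra X r) (frt_algebra X r)
          (frt_class X r {[Gen2 x a]}) (frt_class X r {[Gen2 a y]}) | a. a \<in> X}"

primrec frt_comult_word ::
  "'x set \<Rightarrow> ('x \<times> 'x \<Rightarrow> 'x \<times> 'x) \<Rightarrow> 'x gen list \<Rightarrow> ('x gen list set set \<times> 'x gen list set set) set"
  where
  "frt_comult_word X r [] = tensor_one (frt_algebra X r)"
| "frt_comult_word X r (g # w) =
     tensor_mult (frt_algebra X r) (frt_comult_gen X r g) (frt_comult_word X r w)"

fun frt_counit_gen :: "'x gen \<Rightarrow> unit set" where
  "frt_counit_gen (Gen1 x y) = (if x = y then {()} else {})"
| "frt_counit_gen (Gen2 x y) = (if x = y then {()} else {})"

definition frt_counit_word :: "'x gen list \<Rightarrow> unit set" where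
  "frt_counit_word w = (\<Inter>g \<in> set w. frt_counit_gen g)"

text \<open>
  The coalgebra maps extend the values on generators multiplicatively to words and then by joins to
  sets of words.  They are constant on congruence classes, so taking the join over all
  representatives of a class gives the value at any of them.
\<close>

definition frt_bialgebra ::
  "'x set \<Rightarrow> ('x \<times> 'x \<Rightarrow> 'x \<times> 'x) \<Rightarrow> 'x gen list set set suplat_bialgebra" where
  "frt_bialgebra X r = suplat_algebra.extend (frt_algebra X r)
     (suplat_bialgebra.fields
        (\<lambda>P. \<Squnion>\<^bsub>tensor (frt_algebra X r) (frt_algebra X r)\<^esub> (frt_comult_word X r ` \<Union>P))
        (\<lambda>P. \<Union>w \<in> \<Union>P. frt_counit_word w))"


section \<open>The maps induced by a co-twist\<close>

text \<open>
  Via the coaction \<open>x \<mapsto> \<Squnion>\<^sub>a (x, a)\<^sub>1 \<otimes> a\<close>, the power set of \<open>X\<close> is an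
  \<open>H\<close>-comodule, and \<open>\<F>\<close> acts on tensor products of comodules.  Here
  \<open>F\<close>, \<open>\<Phi>\<close> and \<open>\<Psi>\<close> are the maps on \<open>X \<times> X\<close>, \<open>X \<times> (X \<times> X)\<close> and
  \<open>(X \<times> X) \<times> X\<close> whose graphs are these actions.
\<close>

definition cotwist_induces ::
  "'x set \<Rightarrow> ('x \<times> 'x \<Rightarrow> 'x \<times> 'x) \<Rightarrow>
   (('x gen list set set \<times> 'x gen list set set) set \<Rightarrow> unit set) \<Rightarrow>
   ('x \<times> 'x \<Rightarrow> 'x \<times> 'x) \<Rightarrow> ('x \<times> 'x \<times> 'x \<Rightarrow> 'x \<times> 'x \<times> 'x) \<Rightarrow>
   ('x \<times> 'x \<times> 'x \<Rightarrow> 'x \<times> 'x \<times> 'x) \<Rightarrow> bool" where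
  "cotwist_induces X r \<F> F \<Phi> \<Psi> \<longleftrightarrow>
     (let H = frt_bialgebra X r;
          g = (\<lambda>x y. frt_class X r {[Gen1 x y]});
          \<F>' = (\<lambda>a b. \<F> (pure_tensor H H a b))
      in (\<forall>x \<in> X. \<forall>y \<in> X. \<forall>x' \<in> X. \<forall>y' \<in> X.
            F (x, y) = (x', y') \<longleftrightarrow> \<F>' (g x x') (g y y') = {()}) \<and>
         (\<forall>x \<in> X. \<forall>y \<in> X. \<forall>z \<in> X. \<forall>x' \<in> X. \<forall>y' \<in> X. \<forall>z' \<in> X.
            (\<Phi> (x, y, z) = (x', y', z') \<longleftrightarrow> \<F>' (g x x') (amult H (g y y') (g z z')) = {()}) \<and>
            (\<Psi> (x, y, z) = (x', y', z') \<longleftrightarrow> \<F>' (amult H (g x x') (g y y')) (g z z') = {()})))"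

end

theory Submission
  imports Defs
begin

text \<open>
  A join-preserving map from the FRT algebra \<open>H\<close> to \<open>P(1)\<close> is determined by the words
  \<open>w\<close> whose class it sends to \<open>1\<close>, and the predicates on words that arise in this way are
  those that cannot tell two congruent sets of words apart.  So a co-twist \<open>\<F>\<close> is a binary
  relation on words, and by transporting the Hopf structure along this correspondence each of its
  axioms becomes a statement about relations.

  The coproduct of a word is read off letter by letter: \<open>(x\<^sub>1, y\<^sub>1)\<dots>(x\<^sub>n, y\<^sub>n)\<close> splits into all
  pairs \<open>(x\<^sub>1, a\<^sub>1)\<dots>(x\<^sub>n, a\<^sub>n)\<close> and \<open>(a\<^sub>1, y\<^sub>1)\<dots>(a\<^sub>n, y\<^sub>n)\<close>.  This is matrix
  multiplication: if a word in the letters \<open>(x, y)\<^sub>1\<close> is regarded as an entry in row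
  \<open>x\<^sub>1\<dots>x\<^sub>n\<close> and column \<open>y\<^sub>1\<dots>y\<^sub>n\<close>, then \<open>\<F>\<close> gives for all \<open>m\<close> and \<open>n\<close> a relation
  \<open>\<F>\<^sub>m\<^sub>,\<^sub>n\<close> from \<open>X\<^sup>m \<times> X\<^sup>n\<close> to itself, Sweedler sums are composites of relations, and the counit is
  the identity relation.  Hence

  \<^item> the relations of \<open>\<F>\<close> and of its convolution inverse are mutually inverse, so each
    \<open>\<F>\<^sub>m\<^sub>,\<^sub>n\<close> is the graph of a bijection; take \<open>F\<close>, \<open>\<Phi>\<close>, \<open>\<Psi>\<close> for
    \<open>(m, n) = (1, 1), (1, 2), (2, 1)\<close> (\<open>cotwist_words_inverse\<close>,
    \<open>bij_betw_of_inverse_relations\<close>);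
  \<^item> the cocycle identity for three letters says that \<open>F \<times> id\<close> after \<open>\<Psi>\<close> and
    \<open>id \<times> F\<close> after \<open>\<Phi>\<close> have the same graph (\<open>cotwist_words_cocycle\<close>);
  \<^item> the braiding relation of \<open>H\<close> says that applying \<open>r\<close> to rows and columns simultaneously
    does not change membership, so \<open>\<Phi>\<close> and \<open>\<Psi>\<close> commute with \<open>r\<close>
    (\<open>word_point_relations\<close>).

  Most of the work is to see that the coproduct of \<open>H\<close>, which is a join over all representatives of
  a class, can be computed at a single one (\<open>comult_point\<close>).  Splitting must therefore respect the
  congruence (\<open>splits_respect_frt_cong\<close>): the orthogonality relations kill the splittings with
  mismatched middle indices, and for the braiding relation the pairs of middle indices are permuted
  by the bijection \<open>r\<close>.
\<close>

section \<open>Points of complete lattices\<close>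

text \<open>
  Join-preserving maps to \<open>P(1)\<close>, written as predicates: \<open>\<alpha> a\<close> means that \<open>a\<close> is sent to
  \<open>1\<close>.  For \<open>A = {}\<close> this says that the bottom element is sent to \<open>\<emptyset>\<close>.
\<close>

definition lattice_point :: "('a, 'c) gorder_scheme \<Rightarrow> ('a \<Rightarrow> bool) \<Rightarrow> bool" where
  "lattice_point L \<alpha> \<longleftrightarrow> (\<forall>A \<subseteq> carrier L. \<alpha> (\<Squnion>\<^bsub>L\<^esub>A) \<longleftrightarrow> (\<exists>a \<in> A. \<alpha> a))"

lemma lattice_point_sup:
  "lattice_point L \<alpha> \<Longrightarrow> A \<subseteq> carrier L \<Longrightarrow> \<alpha> (\<Squnion>\<^bsub>L\<^esub>A) \<longleftrightarrow> (\<exists>a \<in> A. \<alpha> a)"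
  by (simp add: lattice_point_def)

lemma lattice_point_hom:
  assumes "f \<in> suplat_hom L suplat_unit"
  shows "lattice_point L (\<lambda>a. () \<in> f a)"
  unfolding lattice_point_def
proof (intro allI impI)
  fix A assume A: "A \<subseteq> carrier L"
  interpret U: complete_lattice suplat_unit
    using assms by (simp add: suplat_hom_def sup_pres_def)
  have fA: "f ` A \<subseteq> carrier suplat_unit" using assms A by (auto simp: suplat_hom_def)
  have le: "x \<sqsubseteq>\<^bsub>suplat_unit\<^esub> y \<longleftrightarrow> x \<subseteq> y" for x y by (simp add: suplat_unit_def)
  have "\<Union>(f ` A) \<in> carrier suplat_unit" by (auto simp: suplat_unit_def)
  then have "\<Squnion>\<^bsub>suplat_unit\<^esub>(f ` A) \<subseteq> \<Union>(f ` A)"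
    using U.sup_least[OF fA, of "\<Union>(f ` A)"] unfolding le by blast
  moreover have "\<Union>(f ` A) \<subseteq> \<Squnion>\<^bsub>suplat_unit\<^esub>(f ` A)"
    using U.sup_upper[OF fA] unfolding le by blast
  moreover have "f (\<Squnion>\<^bsub>L\<^esub>A) = \<Squnion>\<^bsub>suplat_unit\<^esub>(f ` A)"
    using assms A by (simp add: suplat_hom_def sup_pres_def)
  ultimately show "() \<in> f (\<Squnion>\<^bsub>L\<^esub>A) \<longleftrightarrow> (\<exists>a \<in> A. () \<in> f a)" by blast
qed

text \<open>
  Two points \<open>\<alpha>\<close> and \<open>\<beta>\<close> induce the point \<open>\<alpha> \<otimes> \<beta>\<close> of the tensor product.
  An element \<open>U\<close> of the tensor product is the join of the pure tensors of its pairs, so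
  \<open>\<alpha> \<otimes> \<beta>\<close> is an existential statement over \<open>U\<close>.  It fails exactly when \<open>U\<close> lies below the
  element consisting of all pairs at which \<open>\<alpha> \<otimes> \<beta>\<close> vanishes, and a join lies
  below it if and only if all joinands do.
\<close>

lemma tensor_point:
  assumes M: "complete_lattice M" and N: "complete_lattice N"
    and \<alpha>: "lattice_point M \<alpha>" and \<beta>: "lattice_point N \<beta>"
  shows "lattice_point (tensor M N) (\<lambda>U. \<exists>(m, n) \<in> U. \<alpha> m \<and> \<beta> n)"
    and "m \<in> carrier M \<Longrightarrow> n \<in> carrier N \<Longrightarrow>
      (\<exists>(m', n') \<in> pure_tensor M N m n. \<alpha> m' \<and> \<beta> n') \<longleftrightarrow> \<alpha> m \<and> \<beta> n"
proof -
  interpret M: complete_lattice M by fact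
  interpret N: complete_lattice N by fact
  interpret T: complete_lattice "tensor M N" by (rule complete_lattice_tensor) fact+
  \<comment> \<open>The largest element of the tensor product at which the induced point vanishes.\<close>
  let ?T = "{(m, n). m \<in> carrier M \<and> n \<in> carrier N \<and> \<not> (\<alpha> m \<and> \<beta> n)}"
  have T: "?T \<in> carrier (tensor M N)"
    by (rule tensorI) (auto simp: lattice_point_sup[OF \<alpha>] lattice_point_sup[OF \<beta>])
  have iff: "(\<exists>(m, n) \<in> U. \<alpha> m \<and> \<beta> n) \<longleftrightarrow> \<not> U \<subseteq> ?T" if "U \<in> carrier (tensor M N)" for U
    using tensor_subset[OF that] by auto
  show "lattice_point (tensor M N) (\<lambda>U. \<exists>(m, n) \<in> U. \<alpha> m \<and> \<beta> n)"
    unfolding lattice_point_def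
  proof (intro allI impI)
    fix A assume A: "A \<subseteq> carrier (tensor M N)"
    have "(\<exists>(m, n) \<in> \<Squnion>\<^bsub>tensor M N\<^esub>A. \<alpha> m \<and> \<beta> n) \<longleftrightarrow> \<not> \<Squnion>\<^bsub>tensor M N\<^esub>A \<subseteq> ?T"
      by (rule iff) (use A in simp)
    also have "\<dots> \<longleftrightarrow> (\<exists>U \<in> A. \<not> U \<subseteq> ?T)"
      using le_sup_iff[OF T.complete_lattice_axioms A T] unfolding tensor_le by blast
    also have "\<dots> \<longleftrightarrow> (\<exists>U \<in> A. \<exists>(m, n) \<in> U. \<alpha> m \<and> \<beta> n)"
      by (rule bex_cong) (simp_all only: iff[OF subsetD[OF A]])
    finally show "(\<exists>(m, n) \<in> \<Squnion>\<^bsub>tensor M N\<^esub>A. \<alpha> m \<and> \<beta> n) \<longleftrightarrow>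
      (\<exists>U \<in> A. \<exists>(m, n) \<in> U. \<alpha> m \<and> \<beta> n)" .
  qed
  assume mn: "m \<in> carrier M" "n \<in> carrier N"
  show "(\<exists>(m', n') \<in> pure_tensor M N m n. \<alpha> m' \<and> \<beta> n') \<longleftrightarrow> \<alpha> m \<and> \<beta> n"
    using iff[OF pure_tensor_in_iff(1)[OF M N mn]] pure_tensor_in_iff(2)[OF M N mn T] mn by auto
qed

lemma pure_tensors_carrier:
  assumes "complete_lattice M" "complete_lattice N" "P \<subseteq> carrier M \<times> carrier N"
  shows "(\<lambda>(m, n). pure_tensor M N m n) ` P \<subseteq> carrier (tensor M N)"
  using assms(3) pure_tensor_in_iff(1)[OF assms(1,2)] by auto

text \<open>
  A join of pure tensors contains many more pairs than those it is generated by; points cannot see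
  the difference.
\<close>

lemma tensor_point_sup_pure:
  assumes "complete_lattice M" "complete_lattice N" "lattice_point M \<alpha>" "lattice_point N \<beta>"
    and P: "P \<subseteq> carrier M \<times> carrier N"
  shows "(\<exists>(m, n) \<in> \<Squnion>\<^bsub>tensor M N\<^esub> ((\<lambda>(m, n). pure_tensor M N m n) ` P). \<alpha> m \<and> \<beta> n) \<longleftrightarrow>
    (\<exists>(m, n) \<in> P. \<alpha> m \<and> \<beta> n)"
proof -
  from lattice_point_sup[OF tensor_point(1)[OF assms(1-4)] pure_tensors_carrier[OF assms(1,2) P]]
  have "(\<exists>(m, n) \<in> \<Squnion>\<^bsub>tensor M N\<^esub> ((\<lambda>(m, n). pure_tensor M N m n) ` P). \<alpha> m \<and> \<beta> n) \<longleftrightarrow>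
    (\<exists>(m, n) \<in> P. \<exists>(m', n') \<in> pure_tensor M N m n. \<alpha> m' \<and> \<beta> n')"
    by (simp add: split_def)
  also have "\<dots> \<longleftrightarrow> (\<exists>(m, n) \<in> P. \<alpha> m \<and> \<beta> n)"
  proof (rule bex_cong[OF HOL.refl])
    fix z assume "z \<in> P"
    then have "fst z \<in> carrier M" "snd z \<in> carrier N" using P by auto
    from tensor_point(2)[OF assms(1-4) this]
    show "(case z of (m, n) \<Rightarrow> \<exists>(m', n') \<in> pure_tensor M N m n. \<alpha> m' \<and> \<beta> n') \<longleftrightarrow>
      (case z of (m, n) \<Rightarrow> \<alpha> m \<and> \<beta> n)"
      by (simp add: split_def)
  qed
  finally show ?thesis .
qed

lemma pure_tensor_point:
  assumes M: "complete_lattice M" and N: "complete_lattice N" and \<gamma>: "lattice_point (tensor M N) \<gamma>"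
  shows "n \<in> carrier N \<Longrightarrow> lattice_point M (\<lambda>m. \<gamma> (pure_tensor M N m n))"
    and "m \<in> carrier M \<Longrightarrow> lattice_point N (\<lambda>n. \<gamma> (pure_tensor M N m n))"
proof -
  note b = pure_tensor_bimorphism[OF M N, unfolded bimorphism_def suplat_hom_def sup_pres_def]
  show "lattice_point M (\<lambda>m. \<gamma> (pure_tensor M N m n))" if n: "n \<in> carrier N"
    unfolding lattice_point_def
  proof (intro allI impI)
    fix A assume A: "A \<subseteq> carrier M"
    then have "pure_tensor M N (\<Squnion>\<^bsub>M\<^esub>A) n = \<Squnion>\<^bsub>tensor M N\<^esub>((\<lambda>m. pure_tensor M N m n) ` A)"
      using b n by blast
    moreover have "(\<lambda>m. pure_tensor M N m n) ` A \<subseteq> carrier (tensor M N)"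
      using pure_tensor_in_iff(1)[OF M N] A n by blast
    ultimately show "\<gamma> (pure_tensor M N (\<Squnion>\<^bsub>M\<^esub>A) n) \<longleftrightarrow> (\<exists>m \<in> A. \<gamma> (pure_tensor M N m n))"
      using lattice_point_sup[OF \<gamma>] by simp
  qed
  show "lattice_point N (\<lambda>n. \<gamma> (pure_tensor M N m n))" if m: "m \<in> carrier M"
    unfolding lattice_point_def
  proof (intro allI impI)
    fix A assume A: "A \<subseteq> carrier N"
    then have "pure_tensor M N m (\<Squnion>\<^bsub>N\<^esub>A) = \<Squnion>\<^bsub>tensor M N\<^esub>(pure_tensor M N m ` A)"
      using b m by blast
    moreover have "pure_tensor M N m ` A \<subseteq> carrier (tensor M N)"
      using pure_tensor_in_iff(1)[OF M N] A m by blast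
    ultimately show "\<gamma> (pure_tensor M N m (\<Squnion>\<^bsub>N\<^esub>A)) \<longleftrightarrow> (\<exists>n \<in> A. \<gamma> (pure_tensor M N m n))"
      using lattice_point_sup[OF \<gamma>] by simp
  qed
qed

section \<open>Points of the FRT algebra as predicates on words\<close>

lemma frt_class_eqI:
  "ybe_solution X r \<Longrightarrow> frt_cong X r A B \<Longrightarrow> frt_class X r A = frt_class X r B"
  using frt_cong_words[of X r A B] frt_class_eq_iff[of X r A B] by simp

lemma frt_class_carrier: "A \<subseteq> frt_words X \<Longrightarrow> frt_class X r A \<in> carrier (frt_algebra X r)"
  by (simp add: frt_carrier)

lemma frt_carrierE:
  assumes "a \<in> carrier (frt_algebra X r)"
  obtains A where "A \<subseteq> frt_words X" "a = frt_class X r A"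
  using assms unfolding frt_carrier by (elim imageE) simp

lemma frt_class_mem:
  "A \<subseteq> frt_words X \<Longrightarrow> B \<in> frt_class X r A \<longleftrightarrow> frt_cong X r A B"
  by (simp add: frt_class_def)

lemma frt_words_append: "u @ v \<in> frt_words X \<longleftrightarrow> u \<in> frt_words X \<and> v \<in> frt_words X"
  by (auto simp: frt_words_def)

lemma conc_words: "A \<subseteq> frt_words X \<Longrightarrow> B \<subseteq> frt_words X \<Longrightarrow> conc A B \<subseteq> frt_words X"
  by (auto simp: conc_def frt_words_append)

lemma frt_amult:
  assumes r: "ybe_solution X r" and A: "A \<subseteq> frt_words X" and B: "B \<subseteq> frt_words X"
  shows "amult (frt_algebra X r) (frt_class X r A) (frt_class X r B) = frt_class X r (conc A B)"
proof -
  have ne: "frt_class X r A \<noteq> {}" "frt_class X r B \<noteq> {}"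
    using A B frt_class_mem frt_cong.refl by blast+
  have "amult (frt_algebra X r) (frt_class X r A) (frt_class X r B) =
      (\<Union>A' \<in> frt_class X r A. \<Union>B' \<in> frt_class X r B. frt_class X r (conc A' B'))"
    by (simp add: frt_algebra_def)
  also have "\<dots> = (\<Union>A' \<in> frt_class X r A. \<Union>B' \<in> frt_class X r B. frt_class X r (conc A B))"
    by (intro SUP_cong HOL.refl)
      (simp add: frt_class_eqI[OF r frt_cong.sym[OF frt_cong.mult]] frt_class_mem A B)
  also have "\<dots> = frt_class X r (conc A B)" using ne by simp
  finally show ?thesis .
qed

lemma frt_amult_closed:
  assumes "ybe_solution X r" "a \<in> carrier (frt_algebra X r)" "b \<in> carrier (frt_algebra X r)"
  shows "amult (frt_algebra X r) a b \<in> carrier (frt_algebra X r)"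
proof -
  obtain A B where "A \<subseteq> frt_words X" "a = frt_class X r A" "B \<subseteq> frt_words X" "b = frt_class X r B"
    by (rule frt_carrierE[OF assms(2)], rule frt_carrierE[OF assms(3)]) (rule that)
  then show ?thesis using assms(1) by (simp add: frt_amult frt_class_carrier conc_words)
qed

lemma frt_sup:
  assumes r: "ybe_solution X r" and A: "\<A> \<subseteq> Pow (frt_words X)"
  shows "\<Squnion>\<^bsub>frt_algebra X r\<^esub>(frt_class X r ` \<A>) = frt_class X r (\<Union>\<A>)"
proof -
  interpret H: complete_lattice "frt_algebra X r" by (rule complete_lattice_frt[OF r])
  have "frt_class X r ` \<A> \<subseteq> carrier (frt_algebra X r)" using A by (auto simp: frt_carrier)
  then have "least (frt_algebra X r) (\<Squnion>\<^bsub>frt_algebra X r\<^esub>(frt_class X r ` \<A>))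
      (Upper (frt_algebra X r) (frt_class X r ` \<A>))"
    by (rule H.sup_lub)
  then show ?thesis by (rule H.least_unique[OF _ frt_lub[OF r A]])
qed

text \<open>
  The class of a set of words is the join of the classes of its elements, so a point is determined
  by its values at words.
\<close>

lemma frt_lattice_point_iff:
  assumes r: "ybe_solution X r"
  shows "lattice_point (frt_algebra X r) \<alpha> \<longleftrightarrow>
    (\<forall>A \<subseteq> frt_words X. \<alpha> (frt_class X r A) \<longleftrightarrow> (\<exists>w \<in> A. \<alpha> (frt_class X r {w})))"
proof
  assume \<alpha>: "lattice_point (frt_algebra X r) \<alpha>"
  show "\<forall>A \<subseteq> frt_words X. \<alpha> (frt_class X r A) \<longleftrightarrow> (\<exists>w \<in> A. \<alpha> (frt_class X r {w}))"
  proof (intro allI impI)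
    fix A assume A: "A \<subseteq> frt_words X"
    let ?A = "(\<lambda>w. {w}) ` A"
    have "?A \<subseteq> Pow (frt_words X)" "frt_class X r ` ?A \<subseteq> carrier (frt_algebra X r)"
      using A by (auto simp: frt_carrier)
    from frt_sup[OF r this(1)] lattice_point_sup[OF \<alpha> this(2)]
    show "\<alpha> (frt_class X r A) \<longleftrightarrow> (\<exists>w \<in> A. \<alpha> (frt_class X r {w}))"
      by simp
  qed
next
  assume *: "\<forall>A \<subseteq> frt_words X. \<alpha> (frt_class X r A) \<longleftrightarrow> (\<exists>w \<in> A. \<alpha> (frt_class X r {w}))"
  show "lattice_point (frt_algebra X r) \<alpha>"
    unfolding lattice_point_def
  proof (intro allI impI)
    fix B assume "B \<subseteq> carrier (frt_algebra X r)"
    then obtain \<A> where A: "\<A> \<subseteq> Pow (frt_words X)" "B = frt_class X r ` \<A>"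
      unfolding frt_carrier by (meson subset_imageE)
    have "\<Union>\<A> \<subseteq> frt_words X" using A(1) by blast
    then have "\<alpha> (\<Squnion>\<^bsub>frt_algebra X r\<^esub>B) \<longleftrightarrow> (\<exists>w \<in> \<Union>\<A>. \<alpha> (frt_class X r {w}))"
      using * unfolding A(2) frt_sup[OF r A(1)] by blast
    also have "\<dots> \<longleftrightarrow> (\<exists>A \<in> \<A>. \<exists>w \<in> A. \<alpha> (frt_class X r {w}))" by blast
    also have "\<dots> \<longleftrightarrow> (\<exists>A \<in> \<A>. \<alpha> (frt_class X r A))"
      using * A(1) by (intro bex_cong HOL.refl) (metis PowD subsetD)
    finally show "\<alpha> (\<Squnion>\<^bsub>frt_algebra X r\<^esub>B) \<longleftrightarrow> (\<exists>b \<in> B. \<alpha> b)" using A(2) by simp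
  qed
qed

lemma frt_point_mult:
  assumes r: "ybe_solution X r" and \<alpha>: "lattice_point (frt_algebra X r) \<alpha>"
    and c: "c \<in> carrier (frt_algebra X r)"
  shows "lattice_point (frt_algebra X r) (\<lambda>a. \<alpha> (amult (frt_algebra X r) a c))"
    and "lattice_point (frt_algebra X r) (\<lambda>a. \<alpha> (amult (frt_algebra X r) c a))"
proof -
  obtain C where C: "C \<subseteq> frt_words X" "c = frt_class X r C" by (rule frt_carrierE[OF c])
  have ex: "\<alpha> (frt_class X r (conc A B)) \<longleftrightarrow> (\<exists>u \<in> A. \<exists>v \<in> B. \<alpha> (frt_class X r {u @ v}))"
    if "A \<subseteq> frt_words X" "B \<subseteq> frt_words X" for A B
    using \<alpha> conc_words[OF that] unfolding frt_lattice_point_iff[OF r] by (auto simp: conc_def)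
  show "lattice_point (frt_algebra X r) (\<lambda>a. \<alpha> (amult (frt_algebra X r) a c))"
    and "lattice_point (frt_algebra X r) (\<lambda>a. \<alpha> (amult (frt_algebra X r) c a))"
    unfolding frt_lattice_point_iff[OF r] using C
    by (auto simp: frt_amult[OF r] ex subset_iff)
qed

text \<open>
  The predicates on words that come from points of the FRT algebra.
\<close>

definition word_point :: "'x set \<Rightarrow> ('x \<times> 'x \<Rightarrow> 'x \<times> 'x) \<Rightarrow> ('x gen list \<Rightarrow> bool) \<Rightarrow> bool" where
  "word_point X r p \<longleftrightarrow> (\<forall>A B. frt_cong X r A B \<longrightarrow> (\<exists>w \<in> A. p w) = (\<exists>w \<in> B. p w))"

lemma word_point_of_lattice_point:
  assumes r: "ybe_solution X r" and \<alpha>: "lattice_point (frt_algebra X r) \<alpha>"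
  shows "word_point X r (\<lambda>w. \<alpha> (frt_class X r {w}))"
  unfolding word_point_def
proof (intro allI impI)
  fix A B assume AB: "frt_cong X r A B"
  then have "frt_class X r A = frt_class X r B" "A \<subseteq> frt_words X" "B \<subseteq> frt_words X"
    using frt_class_eqI[OF r] frt_cong_words[OF _ r] by blast+
  then show "(\<exists>w \<in> A. \<alpha> (frt_class X r {w})) = (\<exists>w \<in> B. \<alpha> (frt_class X r {w}))"
    using \<alpha> unfolding frt_lattice_point_iff[OF r] by metis
qed

lemma bex_conc: "(\<exists>w \<in> conc A B. P w) \<longleftrightarrow> (\<exists>u \<in> A. \<exists>v \<in> B. P (u @ v))"
  by (auto simp: conc_def)

lemma word_point_append:
  assumes p: "word_point X r p" and u: "u \<in> frt_words X"
  shows "word_point X r (\<lambda>w. p (w @ u))" and "word_point X r (\<lambda>w. p (u @ w))"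
proof -
  have u': "frt_cong X r {u} {u}" using u by (simp add: frt_cong.refl)
  have p': "(\<exists>w \<in> A. p w) = (\<exists>w \<in> B. p w)" if "frt_cong X r A B" for A B
    using p that by (simp add: word_point_def)
  show "word_point X r (\<lambda>w. p (w @ u))" "word_point X r (\<lambda>w. p (u @ w))"
    unfolding word_point_def
    using p'[OF frt_cong.mult[OF _ u']] p'[OF frt_cong.mult[OF u']] by (simp_all add: bex_conc)
qed

text \<open>
  The defining relations of the FRT algebra as seen by a point; the two relations with value
  \<open>\<emptyset>\<close> become injectivity statements.
\<close>

lemma word_point_relations:
  assumes "word_point X r p"
  shows "x \<in> X \<Longrightarrow> (\<exists>a\<in>X. p [Gen1 x a, Gen2 x a]) \<longleftrightarrow> p []"
    and "x \<in> X \<Longrightarrow> (\<exists>a\<in>X. p [Gen2 a x, Gen1 a x]) \<longleftrightarrow> p []"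
    and "\<lbrakk>x \<in> X; y \<in> X; a \<in> X; p [Gen1 x a, Gen2 y a]\<rbrakk> \<Longrightarrow> x = y"
    and "\<lbrakk>x \<in> X; y \<in> X; a \<in> X; p [Gen2 a x, Gen1 a y]\<rbrakk> \<Longrightarrow> x = y"
    and "\<lbrakk>x \<in> X; y \<in> X; a \<in> X; b \<in> X\<rbrakk> \<Longrightarrow> p [Gen1 x y, Gen1 a b] \<longleftrightarrow>
      p [Gen1 (ybe_sigma r x a) (ybe_sigma r y b), Gen1 (ybe_gamma r a x) (ybe_gamma r b y)]"
proof -
  have *: "(\<exists>w \<in> A. p w) = (\<exists>w \<in> B. p w)" if "frt_rel X r A B" for A B
    using assms frt_cong.rel[OF that] unfolding word_point_def by blast
  show "x \<in> X \<Longrightarrow> (\<exists>a\<in>X. p [Gen1 x a, Gen2 x a]) \<longleftrightarrow> p []"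
    using *[OF frt_rel.join12] by auto
  show "x \<in> X \<Longrightarrow> (\<exists>a\<in>X. p [Gen2 a x, Gen1 a x]) \<longleftrightarrow> p []"
    using *[OF frt_rel.join21] by auto
  show "\<lbrakk>x \<in> X; y \<in> X; a \<in> X; p [Gen1 x a, Gen2 y a]\<rbrakk> \<Longrightarrow> x = y"
    using *[OF frt_rel.orth12] by auto
  show "\<lbrakk>x \<in> X; y \<in> X; a \<in> X; p [Gen2 a x, Gen1 a y]\<rbrakk> \<Longrightarrow> x = y"
    using *[OF frt_rel.orth21] by auto
  show "\<lbrakk>x \<in> X; y \<in> X; a \<in> X; b \<in> X\<rbrakk> \<Longrightarrow> p [Gen1 x y, Gen1 a b] \<longleftrightarrow>
      p [Gen1 (ybe_sigma r x a) (ybe_sigma r y b), Gen1 (ybe_gamma r a x) (ybe_gamma r b y)]"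
    using *[OF frt_rel.braid, of x y a b] by auto
qed

section \<open>The coproduct as splitting of words\<close>

text \<open>
  The pairs whose pure tensors have the coproduct of a letter, or of a word, as their join.
\<close>

fun gen_splits :: "'x set \<Rightarrow> 'x gen \<Rightarrow> ('x gen \<times> 'x gen) set" where
  "gen_splits X (Gen1 x y) = (\<lambda>a. (Gen1 x a, Gen1 a y)) ` X"
| "gen_splits X (Gen2 x y) = (\<lambda>a. (Gen2 x a, Gen2 a y)) ` X"

primrec word_splits :: "'x set \<Rightarrow> 'x gen list \<Rightarrow> ('x gen list \<times> 'x gen list) set" where
  "word_splits X [] = {([], [])}"
| "word_splits X (g # w) = (\<lambda>((h, k), (u, v)). (h # u, k # v)) ` (gen_splits X g \<times> word_splits X w)"

lemma bex_word_splits_Cons: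
  "(\<exists>(u, v) \<in> word_splits X (g # w). P u v) \<longleftrightarrow>
    (\<exists>(h, k) \<in> gen_splits X g. \<exists>(u, v) \<in> word_splits X w. P (h # u) (k # v))"
  unfolding word_splits.simps by (simp add: split_def)

lemma bex_word_splits_append:
  "(\<exists>(u, v) \<in> word_splits X (w @ w'). P u v) \<longleftrightarrow>
    (\<exists>(u, v) \<in> word_splits X w. \<exists>(u', v') \<in> word_splits X w'. P (u @ u') (v @ v'))"
proof (induction w arbitrary: P)
  case Nil
  show ?case by simp
next
  case (Cons g w)
  show ?case by (simp only: append_Cons bex_word_splits_Cons Cons.IH)
qed

definition splits_into ::
  "'x set \<Rightarrow> ('x gen list \<Rightarrow> bool) \<Rightarrow> ('x gen list \<Rightarrow> bool) \<Rightarrow> 'x gen list \<Rightarrow> bool" where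
  "splits_into X p q w \<longleftrightarrow> (\<exists>(u, v) \<in> word_splits X w. p u \<and> q v)"

lemma bex_Union_image: "(\<exists>w \<in> \<Union>(f ` R). P w) \<longleftrightarrow> (\<exists>z \<in> R. \<exists>w \<in> f z. P w)"
  by auto

text \<open>
  Fixing the splitting of one factor of a product leaves predicates that are again points, by
  \<open>word_point_append\<close>.  This is what makes multiplication tractable in inductions over arbitrary
  points.
\<close>

lemma splits_into_append_left:
  "splits_into X p q (w @ w') \<longleftrightarrow>
    (\<exists>(u, v) \<in> word_splits X w. splits_into X (\<lambda>u'. p (u @ u')) (\<lambda>v'. q (v @ v')) w')"
  unfolding splits_into_def by (rule bex_word_splits_append)

lemma splits_into_append_right:
  "splits_into X p q (w @ w') \<longleftrightarrow>
    (\<exists>(u', v') \<in> word_splits X w'. splits_into X (\<lambda>u. p (u @ u')) (\<lambda>v. q (v @ v')) w)"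
  unfolding splits_into_append_left unfolding splits_into_def split_def by blast

lemma gen_splits_words:
  "[g] \<in> frt_words X \<Longrightarrow> (h, k) \<in> gen_splits X g \<Longrightarrow> [h] \<in> frt_words X \<and> [k] \<in> frt_words X"
  by (cases g) (auto simp: frt_words_def)

lemma word_splits_words:
  "w \<in> frt_words X \<Longrightarrow> (u, v) \<in> word_splits X w \<Longrightarrow> u \<in> frt_words X \<and> v \<in> frt_words X"
proof (induction w arbitrary: u v)
  case (Cons g w)
  from Cons.prems(2) obtain h k u' v' where hk: "(h, k) \<in> gen_splits X g" "u = h # u'" "v = k # v'"
    and uv: "(u', v') \<in> word_splits X w"
    by auto
  have "[g] \<in> frt_words X" "w \<in> frt_words X" using Cons.prems(1) by (simp_all add: frt_words_def)
  with Cons.IH[OF _ uv] gen_splits_words[OF _ hk(1)] hk(2,3) show ?case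
    by (simp add: frt_words_def)
qed (simp add: frt_words_def)

lemma ybe_closed:
  assumes "ybe_solution X r" "x \<in> X" "y \<in> X"
  shows "ybe_sigma r x y \<in> X" "ybe_gamma r y x \<in> X"
  using assms unfolding ybe_solution_def ybe_sigma_def ybe_gamma_def
  by (metis SigmaI bij_betwE mem_Times_iff)+

lemma ybe_pair_surj:
  assumes "ybe_solution X r" "x \<in> X" "y \<in> X"
  obtains a b where "a \<in> X" "b \<in> X" "ybe_sigma r a b = x" "ybe_gamma r b a = y"
proof -
  have "(x, y) \<in> r ` (X \<times> X)" using assms by (simp add: ybe_solution_def bij_betw_def)
  then obtain a b where "a \<in> X" "b \<in> X" "r (a, b) = (x, y)" by force
  then show ?thesis using that by (simp add: ybe_sigma_def ybe_gamma_def)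
qed

lemma ybe_pair_inj:
  assumes "ybe_solution X r" "x \<in> X" "y \<in> X" "a \<in> X" "b \<in> X"
    and "ybe_sigma r x a = ybe_sigma r y b" "ybe_gamma r a x = ybe_gamma r b y"
  shows "x = y \<and> a = b"
proof -
  have "inj_on r (X \<times> X)" using assms by (simp add: ybe_solution_def bij_betw_def)
  moreover have "r (x, a) = r (y, b)"
    using assms(6,7) by (simp add: ybe_sigma_def ybe_gamma_def prod_eq_iff)
  ultimately show ?thesis using assms(2-5) by (auto dest!: inj_onD)
qed

text \<open>
  In the two relations with value \<open>1\<close>, orthogonality in one tensor factor forces the middle
  indices to agree, after which the join over the outer index and the join over the middle index can
  be taken one after the other.  For the braiding relation, \<open>r\<close> permutes the pairs of middle
  indices.
\<close>

lemma splits_respect_relations: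
  assumes r: "ybe_solution X r" and p: "word_point X r p" and q: "word_point X r q"
    and "frt_rel X r A B"
  shows "(\<exists>w \<in> A. splits_into X p q w) \<longleftrightarrow> (\<exists>w \<in> B. splits_into X p q w)"
  using assms(4)
proof cases
  note P = word_point_relations[OF p] and Q = word_point_relations[OF q]
  case (join12 x)
  have "(\<exists>w \<in> A. splits_into X p q w) \<longleftrightarrow>
      (\<exists>a\<in>X. \<exists>b\<in>X. \<exists>c\<in>X. p [Gen1 x b, Gen2 x c] \<and> q [Gen1 b a, Gen2 c a])"
    using join12(1) by (fastforce simp: splits_into_def image_iff)
  also have "\<dots> \<longleftrightarrow> (\<exists>b\<in>X. p [Gen1 x b, Gen2 x b] \<and> (\<exists>a\<in>X. q [Gen1 b a, Gen2 b a]))"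
    using Q(3) by blast
  also have "\<dots> \<longleftrightarrow> p [] \<and> q []"
    using P(1)[OF join12(3)] Q(1) by auto
  finally show ?thesis using join12(2) by (simp add: splits_into_def)
next
  note P = word_point_relations[OF p] and Q = word_point_relations[OF q]
  case (join21 x)
  have "(\<exists>w \<in> A. splits_into X p q w) \<longleftrightarrow>
      (\<exists>a\<in>X. \<exists>b\<in>X. \<exists>c\<in>X. p [Gen2 a b, Gen1 a c] \<and> q [Gen2 b x, Gen1 c x])"
    using join21(1) by (fastforce simp: splits_into_def image_iff)
  also have "\<dots> \<longleftrightarrow> (\<exists>b\<in>X. (\<exists>a\<in>X. p [Gen2 a b, Gen1 a b]) \<and> q [Gen2 b x, Gen1 b x])"
    using P(4) by blast
  also have "\<dots> \<longleftrightarrow> p [] \<and> q []"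
    using Q(2)[OF join21(3)] P(2) by auto
  finally show ?thesis using join21(2) by (simp add: splits_into_def)
next
  note P = word_point_relations[OF p] and Q = word_point_relations[OF q]
  case (orth12 x y a)
  then show ?thesis using P(3) Q(3) by (auto simp: splits_into_def) blast
next
  note P = word_point_relations[OF p] and Q = word_point_relations[OF q]
  case (orth21 x y a)
  then show ?thesis using P(4) Q(4) by (auto simp: splits_into_def) blast
next
  note P = word_point_relations[OF p] and Q = word_point_relations[OF q]
  case (braid x y a b)
  let ?s = "ybe_sigma r" and ?g = "ybe_gamma r"
  have "(\<exists>w \<in> A. splits_into X p q w) \<longleftrightarrow>
      (\<exists>c\<in>X. \<exists>d\<in>X. p [Gen1 x c, Gen1 a d] \<and> q [Gen1 c y, Gen1 d b])"
    using braid(1) by (auto simp: splits_into_def)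
  also have "\<dots> \<longleftrightarrow> (\<exists>c\<in>X. \<exists>d\<in>X. p [Gen1 (?s x a) (?s c d), Gen1 (?g a x) (?g d c)] \<and>
      q [Gen1 (?s c d) (?s y b), Gen1 (?g d c) (?g b y)])"
    using P(5) Q(5) braid(3-6) by auto
  \<comment> \<open>The middle pairs \<open>(c, d)\<close> and \<open>(e, f) = r (c, d)\<close> run over the same set.\<close>
  also have "\<dots> \<longleftrightarrow> (\<exists>e\<in>X. \<exists>f\<in>X. p [Gen1 (?s x a) e, Gen1 (?g a x) f] \<and>
      q [Gen1 e (?s y b), Gen1 f (?g b y)])" (is "?L \<longleftrightarrow> ?R")
  proof
    show "?L \<Longrightarrow> ?R" using ybe_closed[OF r] by blast
    show "?R \<Longrightarrow> ?L" using ybe_pair_surj[OF r] by metis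
  qed
  finally show ?thesis using braid(2) by (auto simp: splits_into_def)
qed

lemma splits_respect_frt_cong:
  assumes r: "ybe_solution X r" and "frt_cong X r A B"
    and "word_point X r p" "word_point X r q"
  shows "(\<exists>w \<in> A. splits_into X p q w) \<longleftrightarrow> (\<exists>w \<in> B. splits_into X p q w)"
  using assms(2-)
proof (induction arbitrary: p q rule: frt_cong.induct)
  case (rel A B)
  then show ?case using splits_respect_relations[OF r] by blast
next
  case (mult A B C D)
  have words: "B \<subseteq> frt_words X" "C \<subseteq> frt_words X"
    using mult.hyps frt_cong_words[OF _ r] by blast+
  have left: "(\<exists>w \<in> A. splits_into X p q (w @ w')) \<longleftrightarrow> (\<exists>w \<in> B. splits_into X p q (w @ w'))"
    if w': "w' \<in> C" for w'
  proof -
    have "(\<exists>w \<in> A. splits_into X (\<lambda>u. p (u @ u')) (\<lambda>v. q (v @ v')) w) \<longleftrightarrow>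
      (\<exists>w \<in> B. splits_into X (\<lambda>u. p (u @ u')) (\<lambda>v. q (v @ v')) w)"
      if "(u', v') \<in> word_splits X w'" for u' v'
    proof -
      have "u' \<in> frt_words X" "v' \<in> frt_words X" using word_splits_words that w' words(2) by blast+
      then show ?thesis by (intro mult.IH(1) word_point_append(1) mult.prems)
    qed
    then show ?thesis unfolding splits_into_append_right by blast
  qed
  have right: "(\<exists>w' \<in> C. splits_into X p q (w @ w')) \<longleftrightarrow> (\<exists>w' \<in> D. splits_into X p q (w @ w'))"
    if w: "w \<in> B" for w
  proof -
    have "(\<exists>w' \<in> C. splits_into X (\<lambda>u'. p (u @ u')) (\<lambda>v'. q (v @ v')) w') \<longleftrightarrow>
      (\<exists>w' \<in> D. splits_into X (\<lambda>u'. p (u @ u')) (\<lambda>v'. q (v @ v')) w')"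
      if "(u, v) \<in> word_splits X w" for u v
    proof -
      have "u \<in> frt_words X" "v \<in> frt_words X" using word_splits_words that w words(1) by blast+
      then show ?thesis by (intro mult.IH(2) word_point_append(2) mult.prems)
    qed
    then show ?thesis unfolding splits_into_append_left by blast
  qed
  have "(\<exists>w \<in> conc A C. splits_into X p q w) \<longleftrightarrow> (\<exists>w' \<in> C. \<exists>w \<in> A. splits_into X p q (w @ w'))"
    unfolding bex_conc by blast
  also have "\<dots> \<longleftrightarrow> (\<exists>w' \<in> C. \<exists>w \<in> B. splits_into X p q (w @ w'))"
    by (rule bex_cong[OF HOL.refl left])
  also have "\<dots> \<longleftrightarrow> (\<exists>w \<in> B. \<exists>w' \<in> C. splits_into X p q (w @ w'))" by blast
  also have "\<dots> \<longleftrightarrow> (\<exists>w \<in> B. \<exists>w' \<in> D. splits_into X p q (w @ w'))"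
    by (rule bex_cong[OF HOL.refl right])
  finally show ?case unfolding bex_conc .
next
  case (Sup R)
  then have "(\<exists>w \<in> fst z. splits_into X p q w) \<longleftrightarrow> (\<exists>w \<in> snd z. splits_into X p q w)"
    if "z \<in> R" for z
    using that by (auto simp: split_def)
  then show ?case by (simp add: bex_Union_image)
next
  case (sym A B)
  then show ?case by simp
next
  case (trans A B C)
  then show ?case by simp
next
  case (refl A)
  show ?case by (rule HOL.refl)
qed

lemma counit_word_simps:
  "() \<in> frt_counit_word []"
  "() \<in> frt_counit_word (g # w) \<longleftrightarrow> () \<in> frt_counit_gen g \<and> () \<in> frt_counit_word w"
  by (auto simp: frt_counit_word_def)

text \<open>
  Compatibility of the counit with the braiding relation is the injectivity of \<open>r\<close>.
\<close>

lemma word_point_counit: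
  assumes r: "ybe_solution X r"
  shows "word_point X r (\<lambda>w. () \<in> frt_counit_word w)"
proof -
  have "(\<exists>w \<in> A. () \<in> frt_counit_word w) = (\<exists>w \<in> B. () \<in> frt_counit_word w)"
    if "frt_cong X r A B" for A B
    using that
  proof induction
    case (rel A B)
    then show ?case
    proof cases
      case (braid x y a b)
      then show ?thesis using ybe_pair_inj[OF r, of x y a b] by (auto simp: counit_word_simps)
    qed (auto simp: counit_word_simps)
  next
    case (mult A B C D)
    have "(\<exists>w \<in> conc A C. () \<in> frt_counit_word w) \<longleftrightarrow>
      (\<exists>w \<in> A. () \<in> frt_counit_word w) \<and> (\<exists>w \<in> C. () \<in> frt_counit_word w)"
      for A C :: "'a gen list set"
      unfolding bex_conc by (auto simp: frt_counit_word_def ball_Un)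
    with mult.IH show ?case by simp
  next
    case (Sup R)
    then have "(\<exists>w \<in> fst z. () \<in> frt_counit_word w) \<longleftrightarrow> (\<exists>w \<in> snd z. () \<in> frt_counit_word w)"
      if "z \<in> R" for z
      using that by (auto simp: split_def)
    then show ?case by (simp add: bex_Union_image)
  qed simp_all
  then show ?thesis by (simp add: word_point_def)
qed

lemma comult_gen_eq:
  "frt_comult_gen X r g = \<Squnion>\<^bsub>tensor (frt_algebra X r) (frt_algebra X r)\<^esub>
    ((\<lambda>(a, b). pure_tensor (frt_algebra X r) (frt_algebra X r) a b) `
      (\<lambda>(h, k). (frt_class X r {[h]}, frt_class X r {[k]})) ` gen_splits X g)"
  by (cases g) (simp_all only: frt_comult_gen.simps gen_splits.simps image_image split_conv
      setcompr_eq_image Collect_mem_eq)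

lemma gen_split_classes_carrier:
  assumes "[g] \<in> frt_words X"
  shows "(\<lambda>(h, k). (frt_class X r {[h]}, frt_class X r {[k]})) ` gen_splits X g \<subseteq>
    carrier (frt_algebra X r) \<times> carrier (frt_algebra X r)"
  using gen_splits_words[OF assms] by (auto intro!: frt_class_carrier)

lemma comult_gen_carrier:
  assumes r: "ybe_solution X r" and g: "[g] \<in> frt_words X"
  shows "frt_comult_gen X r g \<in> carrier (tensor (frt_algebra X r) (frt_algebra X r))"
proof -
  note B = complete_lattice_frt[OF r]
  interpret T: complete_lattice "tensor (frt_algebra X r) (frt_algebra X r)"
    by (rule complete_lattice_tensor[OF B B])
  show ?thesis
    unfolding comult_gen_eq
    by (rule T.sup_closed[OF pure_tensors_carrier[OF B B gen_split_classes_carrier[OF g]]])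
qed

lemma comult_gen_point:
  assumes r: "ybe_solution X r" and g: "[g] \<in> frt_words X"
    and "lattice_point (frt_algebra X r) \<alpha>" "lattice_point (frt_algebra X r) \<beta>"
  shows "(\<exists>(a, b) \<in> frt_comult_gen X r g. \<alpha> a \<and> \<beta> b) \<longleftrightarrow>
    (\<exists>(h, k) \<in> gen_splits X g. \<alpha> (frt_class X r {[h]}) \<and> \<beta> (frt_class X r {[k]}))"
proof -
  note B = complete_lattice_frt[OF r]
  show ?thesis
    unfolding comult_gen_eq
      tensor_point_sup_pure[OF B B assms(3,4) gen_split_classes_carrier[OF g]]
    by (simp add: split_def)
qed

lemma tensor_mult_eq:
  "tensor_mult H U V = \<Squnion>\<^bsub>tensor H H\<^esub> ((\<lambda>(a, b). pure_tensor H H a b) `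
    (\<lambda>((c, d), (a, b)). (amult H a c, amult H b d)) ` (V \<times> U))"
proof -
  have "{pure_tensor H H (amult H a c) (amult H b d) | a b c d. (a, b) \<in> U \<and> (c, d) \<in> V} =
      (\<lambda>(a, b). pure_tensor H H a b) ` (\<lambda>((c, d), (a, b)). (amult H a c, amult H b d)) ` (V \<times> U)"
    (is "?L = ?R")
  proof (rule Set.set_eqI)
    fix T
    have "T \<in> ?R \<longleftrightarrow> (\<exists>((c, d), (a, b)) \<in> V \<times> U. T = pure_tensor H H (amult H a c) (amult H b d))"
      by (simp only: image_image image_iff split_def prod.sel)
    also have "\<dots> \<longleftrightarrow> T \<in> ?L" by (simp add: Bex_def) metis
    finally show "T \<in> ?L \<longleftrightarrow> T \<in> ?R" ..
  qed
  then show ?thesis by (simp only: tensor_mult_def)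
qed

lemma tensor_products_carrier:
  assumes r: "ybe_solution X r"
    and U: "U \<in> carrier (tensor (frt_algebra X r) (frt_algebra X r))"
    and V: "V \<in> carrier (tensor (frt_algebra X r) (frt_algebra X r))"
  shows "(\<lambda>((c, d), (a, b)). (amult (frt_algebra X r) a c, amult (frt_algebra X r) b d)) ` (V \<times> U) \<subseteq>
    carrier (frt_algebra X r) \<times> carrier (frt_algebra X r)"
  using tensor_subset[OF U] tensor_subset[OF V] by (auto intro!: frt_amult_closed[OF r])

lemma tensor_mult_carrier:
  assumes r: "ybe_solution X r"
    and U: "U \<in> carrier (tensor (frt_algebra X r) (frt_algebra X r))"
    and V: "V \<in> carrier (tensor (frt_algebra X r) (frt_algebra X r))"
  shows "tensor_mult (frt_algebra X r) U V \<in> carrier (tensor (frt_algebra X r) (frt_algebra X r))"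
proof -
  note B = complete_lattice_frt[OF r]
  interpret T: complete_lattice "tensor (frt_algebra X r) (frt_algebra X r)"
    by (rule complete_lattice_tensor[OF B B])
  show ?thesis
    unfolding tensor_mult_eq
    by (rule T.sup_closed[OF pure_tensors_carrier[OF B B tensor_products_carrier[OF r U V]]])
qed

lemma tensor_mult_point:
  assumes r: "ybe_solution X r"
    and "lattice_point (frt_algebra X r) \<alpha>" "lattice_point (frt_algebra X r) \<beta>"
    and U: "U \<in> carrier (tensor (frt_algebra X r) (frt_algebra X r))"
    and V: "V \<in> carrier (tensor (frt_algebra X r) (frt_algebra X r))"
  shows "(\<exists>(a, b) \<in> tensor_mult (frt_algebra X r) U V. \<alpha> a \<and> \<beta> b) \<longleftrightarrow>
    (\<exists>(c, d) \<in> V. \<exists>(a, b) \<in> U.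
      \<alpha> (amult (frt_algebra X r) a c) \<and> \<beta> (amult (frt_algebra X r) b d))"
proof -
  note B = complete_lattice_frt[OF r]
  show ?thesis
    unfolding tensor_mult_eq
      tensor_point_sup_pure[OF B B assms(2,3) tensor_products_carrier[OF r U V]]
    by (simp add: split_def)
qed

lemma comult_word_carrier:
  assumes r: "ybe_solution X r"
  shows "w \<in> frt_words X \<Longrightarrow>
    frt_comult_word X r w \<in> carrier (tensor (frt_algebra X r) (frt_algebra X r))"
proof (induction w)
  case Nil
  have "frt_class X r {[]} \<in> carrier (frt_algebra X r)"
    by (rule frt_class_carrier) (simp add: frt_words_def)
  then show ?case
    using pure_tensor_in_iff(1)[OF complete_lattice_frt[OF r] complete_lattice_frt[OF r]]
    by (simp add: tensor_one_def frt_algebra_def)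
next
  case (Cons g w)
  then have g: "[g] \<in> frt_words X" and w: "w \<in> frt_words X" by (simp_all add: frt_words_def)
  show ?case using tensor_mult_carrier[OF r comult_gen_carrier[OF r g] Cons.IH[OF w]] by simp
qed

text \<open>
  In the induction step the remaining factors of the two halves are absorbed into the points, so the
  claim is needed for all points at once.
\<close>

lemma comult_word_point:
  assumes r: "ybe_solution X r"
  shows "\<lbrakk>w \<in> frt_words X; lattice_point (frt_algebra X r) \<alpha>; lattice_point (frt_algebra X r) \<beta>\<rbrakk> \<Longrightarrow>
    (\<exists>(a, b) \<in> frt_comult_word X r w. \<alpha> a \<and> \<beta> b) \<longleftrightarrow>
    splits_into X (\<lambda>u. \<alpha> (frt_class X r {u})) (\<lambda>v. \<beta> (frt_class X r {v})) w"
proof (induction w arbitrary: \<alpha> \<beta>)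
  case Nil
  have "frt_class X r {[]} \<in> carrier (frt_algebra X r)"
    by (rule frt_class_carrier) (simp add: frt_words_def)
  then show ?case
    using tensor_point(2)[OF complete_lattice_frt[OF r] complete_lattice_frt[OF r] Nil(2,3)]
    by (simp add: tensor_one_def frt_algebra_def splits_into_def)
next
  case (Cons g w)
  let ?B = "frt_algebra X r" and ?c = "\<lambda>w. frt_class X r {w}"
  have g: "[g] \<in> frt_words X" and w: "w \<in> frt_words X"
    using Cons.prems(1) by (simp_all add: frt_words_def)
  have letter: "(\<exists>(a, b) \<in> frt_comult_gen X r g. \<alpha> (amult ?B a c) \<and> \<beta> (amult ?B b d)) \<longleftrightarrow>
      (\<exists>(h, k) \<in> gen_splits X g. \<alpha> (amult ?B (?c [h]) c) \<and> \<beta> (amult ?B (?c [k]) d))"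
    if "(c, d) \<in> frt_comult_word X r w" for c d
  proof -
    have "c \<in> carrier ?B" "d \<in> carrier ?B"
      using tensor_subset[OF comult_word_carrier[OF r w]] that by auto
    then show ?thesis
      by (intro comult_gen_point[OF r g] frt_point_mult(1)[OF r] Cons.prems(2,3))
  qed
  have rest: "(\<exists>(c, d) \<in> frt_comult_word X r w. \<alpha> (amult ?B (?c [h]) c) \<and> \<beta> (amult ?B (?c [k]) d)) \<longleftrightarrow>
      (\<exists>(u, v) \<in> word_splits X w. \<alpha> (?c (h # u)) \<and> \<beta> (?c (k # v)))"
    if "(h, k) \<in> gen_splits X g" for h k
  proof -
    have hk: "[h] \<in> frt_words X" "[k] \<in> frt_words X" using gen_splits_words[OF g that] by auto
    then have "?c [h] \<in> carrier ?B" "?c [k] \<in> carrier ?B" by (simp_all add: frt_class_carrier)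
    then have "(\<exists>(c, d) \<in> frt_comult_word X r w.
        \<alpha> (amult ?B (?c [h]) c) \<and> \<beta> (amult ?B (?c [k]) d)) \<longleftrightarrow>
      splits_into X (\<lambda>u. \<alpha> (amult ?B (?c [h]) (?c u))) (\<lambda>v. \<beta> (amult ?B (?c [k]) (?c v))) w"
      by (intro Cons.IH[OF w] frt_point_mult(2)[OF r] Cons.prems(2,3))
    also have "\<dots> \<longleftrightarrow> (\<exists>(u, v) \<in> word_splits X w. \<alpha> (?c (h # u)) \<and> \<beta> (?c (k # v)))"
      unfolding splits_into_def
    proof (rule bex_cong[OF HOL.refl])
      fix z assume "z \<in> word_splits X w"
      then have "fst z \<in> frt_words X" "snd z \<in> frt_words X"
        using word_splits_words[OF w, of "fst z" "snd z"] by simp_all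
      then show "(case z of (u, v) \<Rightarrow> \<alpha> (amult ?B (?c [h]) (?c u)) \<and> \<beta> (amult ?B (?c [k]) (?c v))) \<longleftrightarrow>
        (case z of (u, v) \<Rightarrow> \<alpha> (?c (h # u)) \<and> \<beta> (?c (k # v)))"
        using hk by (simp add: split_def frt_amult[OF r] conc_def)
    qed
    finally show ?thesis .
  qed
  have "(\<exists>(a, b) \<in> frt_comult_word X r (g # w). \<alpha> a \<and> \<beta> b) \<longleftrightarrow>
    (\<exists>(c, d) \<in> frt_comult_word X r w. \<exists>(a, b) \<in> frt_comult_gen X r g.
      \<alpha> (amult ?B a c) \<and> \<beta> (amult ?B b d))"
    unfolding frt_comult_word.simps
    by (rule tensor_mult_point[OF r Cons.prems(2,3)
          comult_gen_carrier[OF r g] comult_word_carrier[OF r w]])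
  also have "\<dots> \<longleftrightarrow> (\<exists>(c, d) \<in> frt_comult_word X r w. \<exists>(h, k) \<in> gen_splits X g.
      \<alpha> (amult ?B (?c [h]) c) \<and> \<beta> (amult ?B (?c [k]) d))"
    using letter by (intro bex_cong HOL.refl) (simp add: split_paired_all)
  also have "\<dots> \<longleftrightarrow> (\<exists>(h, k) \<in> gen_splits X g. \<exists>(c, d) \<in> frt_comult_word X r w.
      \<alpha> (amult ?B (?c [h]) c) \<and> \<beta> (amult ?B (?c [k]) d))"
    unfolding split_def by blast
  also have "\<dots> \<longleftrightarrow> (\<exists>(h, k) \<in> gen_splits X g. \<exists>(u, v) \<in> word_splits X w.
      \<alpha> (?c (h # u)) \<and> \<beta> (?c (k # v)))"
    using rest by (intro bex_cong HOL.refl) (simp add: split_paired_all)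
  finally show ?case unfolding splits_into_def bex_word_splits_Cons .
qed

lemma frt_bialgebra_simps:
  "carrier (frt_bialgebra X r) = carrier (frt_algebra X r)"
  "le (frt_bialgebra X r) = le (frt_algebra X r)"
  "amult (frt_bialgebra X r) = amult (frt_algebra X r)"
  "aone (frt_bialgebra X r) = aone (frt_algebra X r)"
  "comult (frt_bialgebra X r) P =
    \<Squnion>\<^bsub>tensor (frt_algebra X r) (frt_algebra X r)\<^esub> (frt_comult_word X r ` \<Union>P)"
  "counit (frt_bialgebra X r) P = (\<Union>w \<in> \<Union>P. frt_counit_word w)"
  by (simp_all add: frt_bialgebra_def suplat_algebra.defs suplat_bialgebra.defs)

text \<open>
  Joins are chosen from carrier and order alone, so extending the record by coproduct and counit
  does not affect them.
\<close>

lemma tensor_frt_bialgebra: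
  "tensor (frt_bialgebra X r) (frt_bialgebra X r) = tensor (frt_algebra X r) (frt_algebra X r)"
proof -
  have "Lattice.sup (frt_bialgebra X r) = Lattice.sup (frt_algebra X r)"
    by (rule ext) (simp add: Lattice.sup_def least_def Upper_def frt_bialgebra_simps)
  then show ?thesis by (simp add: tensor_def frt_bialgebra_simps)
qed

lemma pure_tensor_frt_bialgebra:
  "pure_tensor (frt_bialgebra X r) (frt_bialgebra X r) =
    pure_tensor (frt_algebra X r) (frt_algebra X r)"
  by (intro ext) (simp add: pure_tensor_def tensor_frt_bialgebra)

lemma bex_frt_class:
  assumes w: "w \<in> frt_words X" and p: "word_point X r p"
  shows "(\<exists>v \<in> \<Union>(frt_class X r {w}). p v) \<longleftrightarrow> p w"
proof -
  have "(\<exists>v \<in> B. p v) \<longleftrightarrow> p w" if "B \<in> frt_class X r {w}" for B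
    using p that by (auto simp: frt_class_def word_point_def)
  moreover have "{w} \<in> frt_class X r {w}" using w by (simp add: frt_class_mem frt_cong.refl)
  ultimately show ?thesis by blast
qed

text \<open>
  Points cannot distinguish the representatives of a class, so the join over all of them reduces to
  the given word.
\<close>

lemma comult_point:
  assumes r: "ybe_solution X r" and w: "w \<in> frt_words X"
    and \<alpha>: "lattice_point (frt_algebra X r) \<alpha>" and \<beta>: "lattice_point (frt_algebra X r) \<beta>"
  shows "(\<exists>(a, b) \<in> comult (frt_bialgebra X r) (frt_class X r {w}). \<alpha> a \<and> \<beta> b) \<longleftrightarrow>
    splits_into X (\<lambda>u. \<alpha> (frt_class X r {u})) (\<lambda>v. \<beta> (frt_class X r {v})) w"
    (is "?L \<longleftrightarrow> ?S w")
proof -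
  let ?B = "frt_algebra X r" and ?W = "\<Union>(frt_class X r {w})"
  have W: "?W \<subseteq> frt_words X" using frt_cong_words[OF _ r] by (auto simp: frt_class_def)
  have "frt_comult_word X r ` ?W \<subseteq> carrier (tensor ?B ?B)"
    using comult_word_carrier[OF r] W by blast
  from lattice_point_sup[OF tensor_point(1)[OF complete_lattice_frt[OF r] complete_lattice_frt[OF r] \<alpha> \<beta>] this]
  have "?L \<longleftrightarrow> (\<exists>v \<in> ?W. \<exists>(a, b) \<in> frt_comult_word X r v. \<alpha> a \<and> \<beta> b)"
    by (simp only: frt_bialgebra_simps bex_simps)
  also have "\<dots> \<longleftrightarrow> (\<exists>v \<in> ?W. ?S v)"
    using W by (intro bex_cong HOL.refl comult_word_point[OF r _ \<alpha> \<beta>]) blast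
  also have "\<dots> \<longleftrightarrow> ?S w"
  proof (rule bex_frt_class[OF w])
    show "word_point X r ?S"
      unfolding word_point_def
      using splits_respect_frt_cong[OF r] word_point_of_lattice_point[OF r] \<alpha> \<beta> by blast
  qed
  finally show ?thesis .
qed

lemma counit_class:
  assumes "ybe_solution X r" "w \<in> frt_words X"
  shows "() \<in> counit (frt_bialgebra X r) (frt_class X r {w}) \<longleftrightarrow> () \<in> frt_counit_word w"
  using bex_frt_class[OF assms(2) word_point_counit[OF assms(1)]] by (simp add: frt_bialgebra_simps)

section \<open>The co-twist on words\<close>

text \<open>
  Bimorphisms to \<open>P(1)\<close>, written as predicates.
\<close>

definition bipoint :: "('a, 'c) gorder_scheme \<Rightarrow> ('a \<Rightarrow> 'a \<Rightarrow> bool) \<Rightarrow> bool" where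
  "bipoint L S \<longleftrightarrow> (\<forall>a \<in> carrier L. lattice_point L (S a) \<and> lattice_point L (\<lambda>b. S b a))"

lemma comult_carrier:
  assumes r: "ybe_solution X r" and w: "w \<in> frt_words X"
  shows "comult (frt_bialgebra X r) (frt_class X r {w}) \<subseteq>
    carrier (frt_algebra X r) \<times> carrier (frt_algebra X r)"
proof -
  note B = complete_lattice_frt[OF r]
  interpret T: complete_lattice "tensor (frt_algebra X r) (frt_algebra X r)"
    by (rule complete_lattice_tensor[OF B B])
  have "\<Union>(frt_class X r {w}) \<subseteq> frt_words X"
    using frt_cong_words[OF _ r] by (auto simp: frt_class_def)
  then have "frt_comult_word X r ` \<Union>(frt_class X r {w}) \<subseteq>
      carrier (tensor (frt_algebra X r) (frt_algebra X r))"
    using comult_word_carrier[OF r] by blast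
  then show ?thesis
    unfolding frt_bialgebra_simps by (intro tensor_subset T.sup_closed)
qed

text \<open>
  The form of Sweedler sums in the axioms of a co-twist: two coproducts, whose left halves are fed
  into one bimorphism and whose right halves are fed into another.
\<close>

lemma comult_bipoint:
  assumes r: "ybe_solution X r" and w: "w \<in> frt_words X" and w': "w' \<in> frt_words X"
    and S: "bipoint (frt_algebra X r) S" and T: "bipoint (frt_algebra X r) T"
  shows "(\<exists>(a, b) \<in> comult (frt_bialgebra X r) (frt_class X r {w}).
        \<exists>(a', b') \<in> comult (frt_bialgebra X r) (frt_class X r {w'}). S a a' \<and> T b b') \<longleftrightarrow>
    (\<exists>(u, v) \<in> word_splits X w. \<exists>(u', v') \<in> word_splits X w'.
        S (frt_class X r {u}) (frt_class X r {u'}) \<and> T (frt_class X r {v}) (frt_class X r {v'}))"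
    (is "?L \<longleftrightarrow> ?R")
proof -
  let ?c = "\<lambda>w. frt_class X r {w}"
  have "?L \<longleftrightarrow> (\<exists>(a, b) \<in> comult (frt_bialgebra X r) (?c w).
      \<exists>(u', v') \<in> word_splits X w'. S a (?c u') \<and> T b (?c v'))"
  proof (rule bex_cong[OF HOL.refl])
    fix z assume "z \<in> comult (frt_bialgebra X r) (?c w)"
    then have "fst z \<in> carrier (frt_algebra X r)" "snd z \<in> carrier (frt_algebra X r)"
      using comult_carrier[OF r w] by auto
    then have "lattice_point (frt_algebra X r) (S (fst z))" "lattice_point (frt_algebra X r) (T (snd z))"
      using S T by (simp_all add: bipoint_def)
    from comult_point[OF r w' this]
    show "(case z of (a, b) \<Rightarrow> \<exists>(a', b') \<in> comult (frt_bialgebra X r) (?c w'). S a a' \<and> T b b') \<longleftrightarrow>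
      (case z of (a, b) \<Rightarrow> \<exists>(u', v') \<in> word_splits X w'. S a (?c u') \<and> T b (?c v'))"
      by (simp add: split_def splits_into_def)
  qed
  also have "\<dots> \<longleftrightarrow> (\<exists>(u', v') \<in> word_splits X w'.
      \<exists>(a, b) \<in> comult (frt_bialgebra X r) (?c w). S a (?c u') \<and> T b (?c v'))"
    unfolding split_def by blast
  also have "\<dots> \<longleftrightarrow> (\<exists>(u', v') \<in> word_splits X w'.
      \<exists>(u, v) \<in> word_splits X w. S (?c u) (?c u') \<and> T (?c v) (?c v'))"
  proof (rule bex_cong[OF HOL.refl])
    fix z assume "z \<in> word_splits X w'"
    then have "fst z \<in> frt_words X" "snd z \<in> frt_words X"
      using word_splits_words[OF w', of "fst z" "snd z"] by simp_all
    then have "lattice_point (frt_algebra X r) (\<lambda>a. S a (?c (fst z)))"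
      "lattice_point (frt_algebra X r) (\<lambda>b. T b (?c (snd z)))"
      using S T by (simp_all add: bipoint_def frt_class_carrier)
    from comult_point[OF r w this]
    show "(case z of (u', v') \<Rightarrow> \<exists>(a, b) \<in> comult (frt_bialgebra X r) (?c w).
          S a (?c u') \<and> T b (?c v')) \<longleftrightarrow>
      (case z of (u', v') \<Rightarrow> \<exists>(u, v) \<in> word_splits X w. S (?c u) (?c u') \<and> T (?c v) (?c v'))"
      by (simp add: split_def splits_into_def)
  qed
  also have "\<dots> \<longleftrightarrow> ?R" unfolding split_def by blast
  finally show ?thesis .
qed

definition cotwist_words ::
  "'x set \<Rightarrow> ('x \<times> 'x \<Rightarrow> 'x \<times> 'x) \<Rightarrow>
   (('x gen list set set \<times> 'x gen list set set) set \<Rightarrow> unit set) \<Rightarrow>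
   'x gen list \<Rightarrow> 'x gen list \<Rightarrow> bool" where
  "cotwist_words X r \<F> u v \<longleftrightarrow>
    () \<in> \<F> (pure_tensor (frt_algebra X r) (frt_algebra X r) (frt_class X r {u}) (frt_class X r {v}))"

lemma bipoint_hom:
  assumes "complete_lattice L" and "\<F> \<in> suplat_hom (tensor L L) suplat_unit"
  shows "bipoint L (\<lambda>a b. () \<in> \<F> (pure_tensor L L a b))"
  using pure_tensor_point[OF assms(1,1) lattice_point_hom[OF assms(2)]] by (simp add: bipoint_def)

lemma cotwist_words_point:
  assumes r: "ybe_solution X r"
    and "\<F> \<in> suplat_hom (tensor (frt_algebra X r) (frt_algebra X r)) suplat_unit"
    and w: "w \<in> frt_words X"
  shows "word_point X r (cotwist_words X r \<F> w)" and "word_point X r (\<lambda>u. cotwist_words X r \<F> u w)"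
proof -
  have "frt_class X r {w} \<in> carrier (frt_algebra X r)" using w by (simp add: frt_class_carrier)
  with bipoint_hom[OF complete_lattice_frt[OF r] assms(2)]
  have "lattice_point (frt_algebra X r) (\<lambda>b.
      () \<in> \<F> (pure_tensor (frt_algebra X r) (frt_algebra X r) (frt_class X r {w}) b))"
    "lattice_point (frt_algebra X r) (\<lambda>a.
      () \<in> \<F> (pure_tensor (frt_algebra X r) (frt_algebra X r) a (frt_class X r {w})))"
    unfolding bipoint_def by blast+
  from this[THEN word_point_of_lattice_point[OF r]]
  show "word_point X r (cotwist_words X r \<F> w)" and "word_point X r (\<lambda>u. cotwist_words X r \<F> u w)"
    unfolding cotwist_words_def .
qed

lemma convolution_words:
  assumes r: "ybe_solution X r" and w: "w \<in> frt_words X" "w' \<in> frt_words X"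
    and F: "\<F> \<in> suplat_hom (tensor (frt_algebra X r) (frt_algebra X r)) suplat_unit"
    and G: "\<G> \<in> suplat_hom (tensor (frt_algebra X r) (frt_algebra X r)) suplat_unit"
    and conv: "(\<Union>(a1, a2) \<in> comult (frt_bialgebra X r) (frt_class X r {w}).
        \<Union>(b1, b2) \<in> comult (frt_bialgebra X r) (frt_class X r {w'}).
          \<F> (pure_tensor (frt_algebra X r) (frt_algebra X r) a1 b1) \<inter>
          \<G> (pure_tensor (frt_algebra X r) (frt_algebra X r) a2 b2)) =
      counit (frt_bialgebra X r) (frt_class X r {w}) \<inter>
      counit (frt_bialgebra X r) (frt_class X r {w'})"
  shows "(\<exists>(u, v) \<in> word_splits X w. \<exists>(u', v') \<in> word_splits X w'.
      cotwist_words X r \<F> u u' \<and> cotwist_words X r \<G> v v') \<longleftrightarrow>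
    () \<in> frt_counit_word w \<and> () \<in> frt_counit_word w'"
proof -
  note B = complete_lattice_frt[OF r]
  have "(\<exists>(u, v) \<in> word_splits X w. \<exists>(u', v') \<in> word_splits X w'.
      cotwist_words X r \<F> u u' \<and> cotwist_words X r \<G> v v') \<longleftrightarrow>
    (\<exists>(a1, a2) \<in> comult (frt_bialgebra X r) (frt_class X r {w}).
        \<exists>(b1, b2) \<in> comult (frt_bialgebra X r) (frt_class X r {w'}).
          () \<in> \<F> (pure_tensor (frt_algebra X r) (frt_algebra X r) a1 b1) \<and>
          () \<in> \<G> (pure_tensor (frt_algebra X r) (frt_algebra X r) a2 b2))"
    unfolding cotwist_words_def comult_bipoint[OF r w bipoint_hom[OF B F] bipoint_hom[OF B G]] ..
  also have "\<dots> \<longleftrightarrow> () \<in> counit (frt_bialgebra X r) (frt_class X r {w}) \<inter>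
      counit (frt_bialgebra X r) (frt_class X r {w'})"
    unfolding conv[symmetric] by (simp add: split_def)
  finally show ?thesis using counit_class[OF r] w by simp
qed

text \<open>
  Both sides are Sweedler sums of bimorphisms, since \<open>\<F>(a b, c)\<close> for fixed \<open>c\<close> and
  \<open>\<F>(a, b c)\<close> for fixed \<open>a\<close> are bimorphisms in the other two arguments.
\<close>

lemma cotwist_words_cocycle:
  assumes r: "ybe_solution X r" and cotwist: "drinfeld_cotwist (frt_bialgebra X r) \<F>"
    and a: "a \<in> frt_words X" and b: "b \<in> frt_words X" and c: "c \<in> frt_words X"
  shows "(\<exists>(a1, a2) \<in> word_splits X a. \<exists>(b1, b2) \<in> word_splits X b.
      cotwist_words X r \<F> (a1 @ b1) c \<and> cotwist_words X r \<F> a2 b2) \<longleftrightarrow>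
    (\<exists>(b1, b2) \<in> word_splits X b. \<exists>(c1, c2) \<in> word_splits X c.
      cotwist_words X r \<F> a (b1 @ c1) \<and> cotwist_words X r \<F> b2 c2)"
proof -
  let ?H = "frt_bialgebra X r" and ?B = "frt_algebra X r" and ?c = "\<lambda>w. frt_class X r {w}"
  let ?F = "\<lambda>a b. () \<in> \<F> (pure_tensor ?B ?B a b)"
  have cl: "?c w \<in> carrier ?B" if "w \<in> frt_words X" for w using that by (simp add: frt_class_carrier)
  have F: "bipoint ?B ?F"
    using cotwist bipoint_hom[OF complete_lattice_frt[OF r]]
    by (simp add: drinfeld_cotwist_def tensor_frt_bialgebra)
  have F1: "bipoint ?B (\<lambda>a b. ?F (amult ?B a b) (?c c))"
    and F2: "bipoint ?B (\<lambda>b c. ?F (?c a) (amult ?B b c))"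
    using F cl[OF c] cl[OF a] unfolding bipoint_def
    by (auto intro!: frt_point_mult[OF r, of "\<lambda>d. ?F d (?c c)"] frt_point_mult[OF r, of "?F (?c a)"])
  have mult: "amult ?B (?c u) (?c v) = ?c (u @ v)" if "u \<in> frt_words X" "v \<in> frt_words X" for u v
    using that by (simp add: frt_amult[OF r] conc_def)
  have "(\<exists>(a1, a2) \<in> comult ?H (?c a). \<exists>(b1, b2) \<in> comult ?H (?c b).
        ?F (amult ?B a1 b1) (?c c) \<and> ?F a2 b2) \<longleftrightarrow>
      (\<exists>(b1, b2) \<in> comult ?H (?c b). \<exists>(c1, c2) \<in> comult ?H (?c c).
        ?F (?c a) (amult ?B b1 c1) \<and> ?F b2 c2)"
  proof -
    have "?c a \<in> carrier ?H" "?c b \<in> carrier ?H" "?c c \<in> carrier ?H"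
      using cl a b c by (simp_all add: frt_bialgebra_simps)
    then have "(\<Union>(a1, a2) \<in> comult ?H (?c a). \<Union>(b1, b2) \<in> comult ?H (?c b).
        \<F> (pure_tensor ?H ?H (amult ?H a1 b1) (?c c)) \<inter> \<F> (pure_tensor ?H ?H a2 b2)) =
      (\<Union>(b1, b2) \<in> comult ?H (?c b). \<Union>(c1, c2) \<in> comult ?H (?c c).
        \<F> (pure_tensor ?H ?H (?c a) (amult ?H b1 c1)) \<inter> \<F> (pure_tensor ?H ?H b2 c2))" (is "?L = ?R")
      using cotwist unfolding drinfeld_cotwist_def by blast
    then have "() \<in> ?L \<longleftrightarrow> () \<in> ?R" by (rule arg_cong)
    then show ?thesis
      by (simp add: split_def pure_tensor_frt_bialgebra frt_bialgebra_simps(3))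
  qed
  then have *: "(\<exists>(a1, a2) \<in> word_splits X a. \<exists>(b1, b2) \<in> word_splits X b.
        ?F (amult ?B (?c a1) (?c b1)) (?c c) \<and> ?F (?c a2) (?c b2)) \<longleftrightarrow>
      (\<exists>(b1, b2) \<in> word_splits X b. \<exists>(c1, c2) \<in> word_splits X c.
        ?F (?c a) (amult ?B (?c b1) (?c c1)) \<and> ?F (?c b2) (?c c2))"
    unfolding comult_bipoint[OF r a b F1 F] comult_bipoint[OF r b c F2 F] .
  have **: "(\<exists>(u, v) \<in> word_splits X w. \<exists>(u', v') \<in> word_splits X w'. P (amult ?B (?c u) (?c u')) v v') \<longleftrightarrow>
      (\<exists>(u, v) \<in> word_splits X w. \<exists>(u', v') \<in> word_splits X w'. P (?c (u @ u')) v v')"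
    if "w \<in> frt_words X" "w' \<in> frt_words X" for w w' P
  proof -
    have "amult ?B (?c (fst z)) (?c (fst z')) = ?c (fst z @ fst z')"
      if "z \<in> word_splits X w" "z' \<in> word_splits X w'" for z z'
      using that word_splits_words[OF \<open>w \<in> _\<close>, of "fst z" "snd z"]
        word_splits_words[OF \<open>w' \<in> _\<close>, of "fst z'" "snd z'"]
      by (simp add: mult)
    then show ?thesis unfolding split_def by (intro bex_cong HOL.refl) simp
  qed
  show ?thesis
    using * unfolding cotwist_words_def
      **[OF a b, of "\<lambda>d v v'. ?F d (?c c) \<and> ?F (?c v) (?c v')"]
      **[OF b c, of "\<lambda>d v v'. ?F (?c a) d \<and> ?F (?c v) (?c v')"] .
qed

lemma cotwist_words_inverse:
  assumes r: "ybe_solution X r" and cotwist: "drinfeld_cotwist (frt_bialgebra X r) \<F>"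
  obtains G where
    "\<And>w w'. \<lbrakk>w \<in> frt_words X; w' \<in> frt_words X\<rbrakk> \<Longrightarrow>
      (\<exists>(u, v) \<in> word_splits X w. \<exists>(u', v') \<in> word_splits X w'. cotwist_words X r \<F> u u' \<and> G v v') \<longleftrightarrow>
      () \<in> frt_counit_word w \<and> () \<in> frt_counit_word w'"
    "\<And>w w'. \<lbrakk>w \<in> frt_words X; w' \<in> frt_words X\<rbrakk> \<Longrightarrow>
      (\<exists>(u, v) \<in> word_splits X w. \<exists>(u', v') \<in> word_splits X w'. G u u' \<and> cotwist_words X r \<F> v v') \<longleftrightarrow>
      () \<in> frt_counit_word w \<and> () \<in> frt_counit_word w'"
proof -
  let ?H = "frt_bialgebra X r" and ?B = "frt_algebra X r"
  let ?F = "cotwist_words X r \<F>"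
  have F: "\<F> \<in> suplat_hom (tensor ?B ?B) suplat_unit"
    using cotwist by (simp add: drinfeld_cotwist_def tensor_frt_bialgebra)
  obtain \<G> where G: "\<G> \<in> suplat_hom (tensor ?B ?B) suplat_unit"
    and conv: "\<And>a b. a \<in> carrier ?B \<Longrightarrow> b \<in> carrier ?B \<Longrightarrow>
       (\<Union>(a1, a2) \<in> comult ?H a. \<Union>(b1, b2) \<in> comult ?H b.
         \<G> (pure_tensor ?B ?B a1 b1) \<inter> \<F> (pure_tensor ?B ?B a2 b2)) = counit ?H a \<inter> counit ?H b \<and>
       (\<Union>(a1, a2) \<in> comult ?H a. \<Union>(b1, b2) \<in> comult ?H b.
         \<F> (pure_tensor ?B ?B a1 b1) \<inter> \<G> (pure_tensor ?B ?B a2 b2)) = counit ?H a \<inter> counit ?H b"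
    using cotwist
    unfolding drinfeld_cotwist_def tensor_frt_bialgebra pure_tensor_frt_bialgebra frt_bialgebra_simps(1)
    by (elim conjE bexE) (rule that, assumption, (drule (1) bspec)+, assumption)
  let ?G = "cotwist_words X r \<G>"
  have "(\<exists>(u, v) \<in> word_splits X w. \<exists>(u', v') \<in> word_splits X w'. ?F u u' \<and> ?G v v') \<longleftrightarrow>
      () \<in> frt_counit_word w \<and> () \<in> frt_counit_word w'"
    and "(\<exists>(u, v) \<in> word_splits X w. \<exists>(u', v') \<in> word_splits X w'. ?G u u' \<and> ?F v v') \<longleftrightarrow>
      () \<in> frt_counit_word w \<and> () \<in> frt_counit_word w'"
    if w: "w \<in> frt_words X" "w' \<in> frt_words X" for w w'
  proof -
    have "frt_class X r {w} \<in> carrier ?B" "frt_class X r {w'} \<in> carrier ?B"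
      using w by (simp_all add: frt_class_carrier)
    note conv = conv[OF this]
    show "(\<exists>(u, v) \<in> word_splits X w. \<exists>(u', v') \<in> word_splits X w'. ?F u u' \<and> ?G v v') \<longleftrightarrow>
      () \<in> frt_counit_word w \<and> () \<in> frt_counit_word w'"
      by (rule convolution_words[OF r w F G conjunct2[OF conv]])
    show "(\<exists>(u, v) \<in> word_splits X w. \<exists>(u', v') \<in> word_splits X w'. ?G u u' \<and> ?F v v') \<longleftrightarrow>
      () \<in> frt_counit_word w \<and> () \<in> frt_counit_word w'"
      by (rule convolution_words[OF r w G F conjunct1[OF conv]])
  qed
  then show thesis by (rule that)
qed

section \<open>The induced twist\<close>

text \<open>
  In the category of sets and relations, the isomorphisms are the graphs of bijections.
\<close>

lemma bij_betw_of_inverse_relations: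
  assumes RS: "\<And>s t. s \<in> T \<Longrightarrow> t \<in> T \<Longrightarrow> (\<exists>m \<in> T. R s m \<and> S m t) \<longleftrightarrow> s = t"
    and SR: "\<And>s t. s \<in> T \<Longrightarrow> t \<in> T \<Longrightarrow> (\<exists>m \<in> T. S s m \<and> R m t) \<longleftrightarrow> s = t"
  shows "\<exists>f. bij_betw f T T \<and> (\<forall>s \<in> T. \<forall>t \<in> T. f s = t \<longleftrightarrow> R s t)"
proof -
  have "\<forall>s \<in> T. \<exists>m. m \<in> T \<and> R s m \<and> S m s" using RS by blast
  then obtain f where f: "\<And>s. s \<in> T \<Longrightarrow> f s \<in> T \<and> R s (f s) \<and> S (f s) s" by metis
  have iff: "f s = t \<longleftrightarrow> R s t" if "s \<in> T" "t \<in> T" for s t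
    using f[OF that(1)] SR[of "f s" t] that by blast
  have "inj_on f T"
    using f RS by (metis inj_onI)
  moreover have "\<exists>s \<in> T. f s = t" if t: "t \<in> T" for t
  proof -
    obtain s where "s \<in> T" "R s t" using SR[OF t t] by blast
    then show ?thesis using iff t by blast
  qed
  then have "f ` T = T" using f by blast
  ultimately have "bij_betw f T T" by (simp add: bij_betw_def)
  then show ?thesis using iff by blast
qed

lemma bex_splits_Gen1:
  "(\<exists>(u, v) \<in> word_splits X [Gen1 x y]. P u v) \<longleftrightarrow> (\<exists>a \<in> X. P [Gen1 x a] [Gen1 a y])"
  "(\<exists>(u, v) \<in> word_splits X [Gen1 x y, Gen1 x' y']. P u v) \<longleftrightarrow>
    (\<exists>a \<in> X. \<exists>b \<in> X. P [Gen1 x a, Gen1 x' b] [Gen1 a y, Gen1 b y'])"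
  unfolding bex_word_splits_Cons by simp_all

lemma frt_words_Gen1:
  "[Gen1 x y] \<in> frt_words X \<longleftrightarrow> x \<in> X \<and> y \<in> X"
  "[Gen1 x y, Gen1 x' y'] \<in> frt_words X \<longleftrightarrow> x \<in> X \<and> y \<in> X \<and> x' \<in> X \<and> y' \<in> X"
  by (auto simp: frt_words_def)

theorem theorem3p3:
  fixes X :: "'x set"
    and r :: "'x \<times> 'x \<Rightarrow> 'x \<times> 'x"
    and \<F> :: "('x gen list set set \<times> 'x gen list set set) set \<Rightarrow> unit set"
  assumes "ybe_solution X r"
    and "nondegenerate X r"
    and "drinfeld_cotwist (frt_bialgebra X r) \<F>"
  shows "\<exists>F \<Phi> \<Psi>. cotwist_induces X r \<F> F \<Phi> \<Psi> \<and> drinfeld_twist X r F \<Phi> \<Psi>"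
proof -
  note r = assms(1)
  let ?B = "frt_algebra X r"
  let ?F = "cotwist_words X r \<F>"
  have F: "\<F> \<in> suplat_hom (tensor ?B ?B) suplat_unit"
    using assms(3) by (simp add: drinfeld_cotwist_def tensor_frt_bialgebra)
  obtain G where FG: "\<And>w w'. \<lbrakk>w \<in> frt_words X; w' \<in> frt_words X\<rbrakk> \<Longrightarrow>
      (\<exists>(u, v) \<in> word_splits X w. \<exists>(u', v') \<in> word_splits X w'. ?F u u' \<and> G v v') \<longleftrightarrow>
      () \<in> frt_counit_word w \<and> () \<in> frt_counit_word w'"
    and GF: "\<And>w w'. \<lbrakk>w \<in> frt_words X; w' \<in> frt_words X\<rbrakk> \<Longrightarrow>
      (\<exists>(u, v) \<in> word_splits X w. \<exists>(u', v') \<in> word_splits X w'. G u u' \<and> ?F v v') \<longleftrightarrow>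
      () \<in> frt_counit_word w \<and> () \<in> frt_counit_word w'"
    by (rule cotwist_words_inverse[OF r assms(3)]) (rule that)
  note words = frt_words_Gen1 bex_splits_Gen1 counit_word_simps
  \<comment> \<open>The relations \<open>\<F>\<^sub>1\<^sub>,\<^sub>1\<close>, \<open>\<F>\<^sub>1\<^sub>,\<^sub>2\<close> and \<open>\<F>\<^sub>2\<^sub>,\<^sub>1\<close>, for the co-twist and for its inverse alike.\<close>
  define R\<^sub>F where "R\<^sub>F = (\<lambda>(K :: 'x gen list \<Rightarrow> 'x gen list \<Rightarrow> bool) (x, y) (x', y'). K [Gen1 x x'] [Gen1 y y'])"
  define R\<^sub>\<Phi> where "R\<^sub>\<Phi> = (\<lambda>(K :: 'x gen list \<Rightarrow> 'x gen list \<Rightarrow> bool) (x, y, z) (x', y', z').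
    K [Gen1 x x'] [Gen1 y y', Gen1 z z'])"
  define R\<^sub>\<Psi> where "R\<^sub>\<Psi> = (\<lambda>(K :: 'x gen list \<Rightarrow> 'x gen list \<Rightarrow> bool) (x, y, z) (x', y', z').
    K [Gen1 x x', Gen1 y y'] [Gen1 z z'])"
  have "\<exists>f. bij_betw f (X \<times> X) (X \<times> X) \<and>
    (\<forall>s \<in> X \<times> X. \<forall>t \<in> X \<times> X. f s = t \<longleftrightarrow> R\<^sub>F ?F s t)"
  proof (rule bij_betw_of_inverse_relations)
    fix s t assume "s \<in> X \<times> X" "t \<in> X \<times> X"
    then obtain x y x' y' where [simp]: "s = (x, y)" "t = (x', y')"
      and "x \<in> X" "y \<in> X" "x' \<in> X" "y' \<in> X" by auto
    then show "(\<exists>m \<in> X \<times> X. R\<^sub>F ?F s m \<and> R\<^sub>F G m t) \<longleftrightarrow> s = t"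
      and "(\<exists>m \<in> X \<times> X. R\<^sub>F G s m \<and> R\<^sub>F ?F m t) \<longleftrightarrow> s = t"
      using FG[of "[Gen1 x x']" "[Gen1 y y']"] GF[of "[Gen1 x x']" "[Gen1 y y']"]
      by (simp_all add: words R\<^sub>F_def split: if_splits)
  qed
  then obtain F where F_bij: "bij_betw F (X \<times> X) (X \<times> X)"
    and "\<forall>s \<in> X \<times> X. \<forall>t \<in> X \<times> X. F s = t \<longleftrightarrow> R\<^sub>F ?F s t"
    by (elim exE conjE) (rule that)
  note F_iff = this(2)[rule_format]
  have "\<exists>f. bij_betw f (X \<times> X \<times> X) (X \<times> X \<times> X) \<and>
    (\<forall>s \<in> X \<times> X \<times> X. \<forall>t \<in> X \<times> X \<times> X. f s = t \<longleftrightarrow> R\<^sub>\<Phi> ?F s t)"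
  proof (rule bij_betw_of_inverse_relations)
    fix s t assume "s \<in> X \<times> X \<times> X" "t \<in> X \<times> X \<times> X"
    then obtain x y z x' y' z' where [simp]: "s = (x, y, z)" "t = (x', y', z')"
      and "x \<in> X" "y \<in> X" "z \<in> X" "x' \<in> X" "y' \<in> X" "z' \<in> X" by auto
    then show "(\<exists>m \<in> X \<times> X \<times> X. R\<^sub>\<Phi> ?F s m \<and> R\<^sub>\<Phi> G m t) \<longleftrightarrow> s = t"
      and "(\<exists>m \<in> X \<times> X \<times> X. R\<^sub>\<Phi> G s m \<and> R\<^sub>\<Phi> ?F m t) \<longleftrightarrow> s = t"
      using FG[of "[Gen1 x x']" "[Gen1 y y', Gen1 z z']"] GF[of "[Gen1 x x']" "[Gen1 y y', Gen1 z z']"]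
      by (simp_all add: words R\<^sub>\<Phi>_def split: if_splits)
  qed
  then obtain \<Phi> where \<Phi>_bij: "bij_betw \<Phi> (X \<times> X \<times> X) (X \<times> X \<times> X)"
    and "\<forall>s \<in> X \<times> X \<times> X. \<forall>t \<in> X \<times> X \<times> X. \<Phi> s = t \<longleftrightarrow> R\<^sub>\<Phi> ?F s t"
    by (elim exE conjE) (rule that)
  note \<Phi>_iff = this(2)[rule_format]
  have "\<exists>f. bij_betw f (X \<times> X \<times> X) (X \<times> X \<times> X) \<and>
    (\<forall>s \<in> X \<times> X \<times> X. \<forall>t \<in> X \<times> X \<times> X. f s = t \<longleftrightarrow> R\<^sub>\<Psi> ?F s t)"
  proof (rule bij_betw_of_inverse_relations)
    fix s t assume "s \<in> X \<times> X \<times> X" "t \<in> X \<times> X \<times> X"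
    then obtain x y z x' y' z' where [simp]: "s = (x, y, z)" "t = (x', y', z')"
      and "x \<in> X" "y \<in> X" "z \<in> X" "x' \<in> X" "y' \<in> X" "z' \<in> X" by auto
    then show "(\<exists>m \<in> X \<times> X \<times> X. R\<^sub>\<Psi> ?F s m \<and> R\<^sub>\<Psi> G m t) \<longleftrightarrow> s = t"
      and "(\<exists>m \<in> X \<times> X \<times> X. R\<^sub>\<Psi> G s m \<and> R\<^sub>\<Psi> ?F m t) \<longleftrightarrow> s = t"
      using FG[of "[Gen1 x x', Gen1 y y']" "[Gen1 z z']"] GF[of "[Gen1 x x', Gen1 y y']" "[Gen1 z z']"]
      by (simp_all add: words R\<^sub>\<Psi>_def split: if_splits)
  qed
  then obtain \<Psi> where \<Psi>_bij: "bij_betw \<Psi> (X \<times> X \<times> X) (X \<times> X \<times> X)"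
    and "\<forall>s \<in> X \<times> X \<times> X. \<forall>t \<in> X \<times> X \<times> X. \<Psi> s = t \<longleftrightarrow> R\<^sub>\<Psi> ?F s t"
    by (elim exE conjE) (rule that)
  note \<Psi>_iff = this(2)[rule_format]
  have unit: "U = {()} \<longleftrightarrow> () \<in> U" for U :: "unit set" by auto
  have "cotwist_induces X r \<F> F \<Phi> \<Psi>"
    unfolding cotwist_induces_def Let_def unit pure_tensor_frt_bialgebra frt_bialgebra_simps(3)
    by (simp add: F_iff \<Phi>_iff \<Psi>_iff R\<^sub>F_def R\<^sub>\<Phi>_def R\<^sub>\<Psi>_def cotwist_words_def
        frt_amult[OF r] conc_def frt_words_Gen1)
  moreover have "on12 F (\<Psi> t) = on23 F (\<Phi> t)" if t: "t \<in> X \<times> X \<times> X" for t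
  proof -
    obtain x y z where t_def: "t = (x, y, z)" by (cases t)
    obtain p q s where \<Psi>t: "\<Psi> t = (p, q, s)" by (cases "\<Psi> t")
    obtain x' y' where Fpq: "F (p, q) = (x', y')" by (cases "F (p, q)")
    have xyz: "x \<in> X" "y \<in> X" "z \<in> X" using t t_def by auto
    have pqs: "p \<in> X" "q \<in> X" "s \<in> X" using bij_betw_apply[OF \<Psi>_bij t] \<Psi>t by auto
    have xy': "x' \<in> X" "y' \<in> X" using bij_betw_apply[OF F_bij, of "(p, q)"] pqs Fpq by auto
    have "?F [Gen1 x p, Gen1 y q] [Gen1 z s]" "?F [Gen1 p x'] [Gen1 q y']"
      using \<Psi>_iff[OF t, of "(p, q, s)"] F_iff[of "(p, q)" "(x', y')"] \<Psi>t Fpq pqs xy'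
      by (auto simp: R\<^sub>\<Psi>_def R\<^sub>F_def t_def)
    \<comment> \<open>\<open>(x', y', s)\<close> is the common value; the cocycle identity supplies the middle of the other path.\<close>
    then obtain e f where ef: "e \<in> X" "f \<in> X"
      "?F [Gen1 x x'] [Gen1 y e, Gen1 z f]" "?F [Gen1 e y'] [Gen1 f s]"
      using cotwist_words_cocycle[OF r assms(3), of "[Gen1 x x']" "[Gen1 y y']" "[Gen1 z s]"] pqs xyz xy'
      by (auto simp: words)
    then have "\<Phi> t = (x', e, f)" "F (e, f) = (y', s)"
      using \<Phi>_iff[OF t, of "(x', e, f)"] F_iff[of "(e, f)" "(y', s)"] pqs xy'
      by (auto simp: R\<^sub>\<Phi>_def R\<^sub>F_def t_def)
    with \<Psi>t Fpq show ?thesis by (simp add: on12_def on23_def)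
  qed
  moreover have "\<Phi> (on23 r t) = on23 r (\<Phi> t)" if t: "t \<in> X \<times> X \<times> X" for t
  proof -
    obtain x y z where t_def: "t = (x, y, z)" by (cases t)
    obtain x' y' z' where \<Phi>t: "\<Phi> t = (x', y', z')" by (cases "\<Phi> t")
    have X: "x \<in> X" "y \<in> X" "z \<in> X" using t t_def by auto
    have X': "x' \<in> X" "y' \<in> X" "z' \<in> X" using bij_betw_apply[OF \<Phi>_bij t] \<Phi>t by auto
    have ryz: "r (u, v) = (ybe_sigma r u v, ybe_gamma r v u)" for u v
      by (simp add: ybe_sigma_def ybe_gamma_def)
    have "?F [Gen1 x x'] [Gen1 y y', Gen1 z z']"
      using \<Phi>_iff[OF t, of "(x', y', z')"] \<Phi>t X' by (simp add: R\<^sub>\<Phi>_def t_def)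
    then have "?F [Gen1 x x'] [Gen1 (ybe_sigma r y z) (ybe_sigma r y' z'),
        Gen1 (ybe_gamma r z y) (ybe_gamma r z' y')]"
      using word_point_relations(5)[OF cotwist_words_point(1)[OF r F]] X X' by (simp add: frt_words_Gen1)
    then have "\<Phi> (x, r (y, z)) = (x', r (y', z'))"
      unfolding ryz using X X' by (subst \<Phi>_iff) (auto simp: R\<^sub>\<Phi>_def intro: ybe_closed[OF r])
    then show ?thesis by (simp add: on23_def t_def \<Phi>t[unfolded t_def])
  qed
  moreover have "\<Psi> (on12 r t) = on12 r (\<Psi> t)" if t: "t \<in> X \<times> X \<times> X" for t
  proof -
    obtain x y z where t_def: "t = (x, y, z)" by (cases t)
    obtain x' y' z' where \<Psi>t: "\<Psi> t = (x', y', z')" by (cases "\<Psi> t")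
    have X: "x \<in> X" "y \<in> X" "z \<in> X" using t t_def by auto
    have X': "x' \<in> X" "y' \<in> X" "z' \<in> X" using bij_betw_apply[OF \<Psi>_bij t] \<Psi>t by auto
    have rxy: "r (u, v) = (ybe_sigma r u v, ybe_gamma r v u)" for u v
      by (simp add: ybe_sigma_def ybe_gamma_def)
    have "?F [Gen1 x x', Gen1 y y'] [Gen1 z z']"
      using \<Psi>_iff[OF t, of "(x', y', z')"] \<Psi>t X' by (simp add: R\<^sub>\<Psi>_def t_def)
    then have "?F [Gen1 (ybe_sigma r x y) (ybe_sigma r x' y'),
        Gen1 (ybe_gamma r y x) (ybe_gamma r y' x')] [Gen1 z z']"
      using word_point_relations(5)[OF cotwist_words_point(2)[OF r F]] X X' by (simp add: frt_words_Gen1)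
    then have "\<Psi> (ybe_sigma r x y, ybe_gamma r y x, z) = (ybe_sigma r x' y', ybe_gamma r y' x', z')"
      using X X' by (subst \<Psi>_iff) (auto simp: R\<^sub>\<Psi>_def intro: ybe_closed[OF r])
    then show ?thesis by (simp add: on12_def t_def \<Psi>t[unfolded t_def] rxy)
  qed
  ultimately show ?thesis
    unfolding drinfeld_twist_def using F_bij \<Phi>_bij \<Psi>_bij by blast
qed

end
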